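(* Let $M\subset\mathbb{R}^N$ be a smooth $d$-manifold. Let $\mathcal{U}=\{U_i\}_{i=1}^n$ be a good cover of $M$ in which each $U_i$ is diffeomorphic to an open subset of $\mathbb{R}^d$. Then there exists a smooth autoencoder atlas $\mathcal{A}=\{(U_i,E_i,D_i)\}_{i=1}^n$ with $n$ charts such that $\mathcal{T}_{\mathcal{A}}\cong TM$. Conversely, any smooth autoencoder atlas $\mathcal{A}=\{(U_i,E_i,D_i)\}_{i=1}^n$ on $M$ with $\mathcal{T}_{\mathcal{A}}\cong TM$ provides a trivializing cover of $TM$ with $n$ open sets, each diffeomorphic to an open subset of $\mathbb{R}^d$; that is, $\{U_i\}_{i=1}^n$ is an open cover of $M$, $TM|_{U_i}$ is trivial for every $i$, and each $U_i$ is diffeomorphic to an open subset of $\mathbb{R}^d$.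
   Context: A good cover of $M$ is a finite open cover $\{U_i\}$ such that each $U_i$ is contractible and every connected component of every nonempty finite intersection is contractible. A smooth autoencoder chart on $M$ is a triple $(U,E,D)$ with $U\subset M$ open, $E:U\to Z\subset\mathbb{R}^d$ smooth and a diffeomorphism onto its image, $D:Z\to M$ smooth, and $D\circ E=\mathrm{Id}_U$. A smooth autoencoder atlas is a collection of such charts whose domains cover $M$. With $T_{ji}=E_j\circ D_i$ on $E_i(U_i\cap U_j)$ and $g_{ji}(x)=d(T_{ji})_{E_i(x)}\in\mathrm{GL}_d(\mathbb{R})$, the tangent bundle of the atlas is $\mathcal{T}_{\mathcal{A}}=\bigl(\bigsqcup_iU_i\times\mathbb{R}^d\bigr)/\sim$, $(x,v)_i\sim(x,g_{ji}(x)v)_j$ for $x\in U_i\cap U_j$; it is a rank-$d$ vector bundle over $M$. *)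

theory Defs
  imports "HOL-Analysis.Analysis"
begin

section \<open>Smooth maps between subsets of Euclidean spaces\<close>

text \<open>On an open subset of a finite-dimensional space, \<open>Ck_on k W f\<close> says that \<open>f\<close> is of class
  $C^k$: all iterated directional derivatives of order up to \<open>k\<close> exist and are continuous.\<close>

primrec Ck_on :: "nat \<Rightarrow> 'a::euclidean_space set \<Rightarrow> ('a \<Rightarrow> 'b::real_normed_vector) \<Rightarrow> bool" where
  "Ck_on 0 W f \<longleftrightarrow> continuous_on W f"
| "Ck_on (Suc k) W f \<longleftrightarrow>
     (\<forall>x\<in>W. f differentiable (at x)) \<and> (\<forall>v. Ck_on k W (\<lambda>x. frechet_derivative f (at x) v))"

text \<open>Smoothness on an arbitrary subset: near each point of \<open>S\<close>, the map extends to a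
  \<open>C\<^sup>\<infinity>\<close> map on an open subset of the ambient space.\<close>

definition smooth_on :: "'a::euclidean_space set \<Rightarrow> ('a \<Rightarrow> 'b::real_normed_vector) \<Rightarrow> bool" where
  "smooth_on S f \<longleftrightarrow>
     (\<forall>x\<in>S. \<exists>W g. open W \<and> x \<in> W \<and> (\<forall>k. Ck_on k W g) \<and> (\<forall>y\<in>W \<inter> S. g y = f y))"

definition diffeomorphism ::
  "'a::euclidean_space set \<Rightarrow> 'b::euclidean_space set \<Rightarrow> ('a \<Rightarrow> 'b) \<Rightarrow> ('b \<Rightarrow> 'a) \<Rightarrow> bool" where
  "diffeomorphism S T f g \<longleftrightarrow>
     smooth_on S f \<and> smooth_on T g \<and> f ` S = T \<and> g ` T = S \<and>
     (\<forall>x\<in>S. g (f x) = x) \<and> (\<forall>y\<in>T. f (g y) = y)"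

definition diffeomorphic :: "'a::euclidean_space set \<Rightarrow> 'b::euclidean_space set \<Rightarrow> bool" where
  "diffeomorphic S T \<longleftrightarrow> (\<exists>f g. diffeomorphism S T f g)"

section \<open>Embedded manifolds and good covers\<close>

text \<open>The dimension of the manifold is the cardinality of the index type \<open>'d\<close>.\<close>

definition smooth_manifold :: "'d::finite itself \<Rightarrow> (real^'N) set \<Rightarrow> bool" where
  "smooth_manifold d M \<longleftrightarrow>
     (\<forall>x\<in>M. \<exists>V (W :: (real^'d) set).
        openin (top_of_set M) V \<and> x \<in> V \<and> open W \<and> diffeomorphic V W)"

definition finite_open_cover ::
  "'a::topological_space set \<Rightarrow> nat \<Rightarrow> (nat \<Rightarrow> 'a set) \<Rightarrow> bool" where
  "finite_open_cover M n U \<longleftrightarrow>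
     (\<forall>i\<in>{1..n}. openin (top_of_set M) (U i)) \<and> (\<Union>i\<in>{1..n}. U i) = M"

text \<open>Nonemptiness of the members is required separately because \<^const>\<open>contractible\<close> holds
  of the empty set.\<close>

definition good_cover ::
  "'a::real_normed_vector set \<Rightarrow> nat \<Rightarrow> (nat \<Rightarrow> 'a set) \<Rightarrow> bool" where
  "good_cover M n U \<longleftrightarrow>
     finite_open_cover M n U \<and>
     (\<forall>i\<in>{1..n}. U i \<noteq> {} \<and> contractible (U i)) \<and>
     (\<forall>J. J \<subseteq> {1..n} \<and> J \<noteq> {} \<and> (\<Inter>i\<in>J. U i) \<noteq> {} \<longrightarrow>
        (\<forall>C\<in>components (\<Inter>i\<in>J. U i). contractible C))"

section \<open>Smooth vector bundles\<close>

text \<open>A vector bundle of rank \<open>CARD('d)\<close> over a subset of \<open>'x\<close> is given by its total space, its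
  projection and a family of smooth local trivialisations. A trivialisation over \<open>V\<close> is stored as
  a pair \<open>(V, \<phi>)\<close> where \<open>\<phi>\<close> maps \<open>V \<times> \<real>\<^sup>d\<close> onto the part of the total space over \<open>V\<close>; these
  parametrisations carry both the linear structure of the fibres and the smooth structure of the
  total space.\<close>

record ('e, 'x, 'd) vbundle =
  total :: "'e topology"
  proj :: "'e \<Rightarrow> 'x"
  trivs :: "('x set \<times> ('x \<times> (real^'d) \<Rightarrow> 'e)) set"

text \<open>Smooth bundle maps over the identity of the base: continuous, fibre preserving, and in any
  two local trivialisations given by a matrix depending smoothly on the base point.\<close>

definition vb_hom ::
  "('e, 'x::euclidean_space, 'd::finite) vbundle \<Rightarrow> ('f, 'x, 'd) vbundle \<Rightarrow> ('e \<Rightarrow> 'f) \<Rightarrow> bool" where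
  "vb_hom A B F \<longleftrightarrow>
     continuous_map (total A) (total B) F \<and>
     (\<forall>e\<in>topspace (total A). proj B (F e) = proj A e) \<and>
     (\<forall>(V, \<phi>)\<in>trivs A. \<forall>(W, \<psi>)\<in>trivs B. \<exists>h :: 'x \<Rightarrow> real^'d^'d.
        smooth_on (V \<inter> W) h \<and> (\<forall>x\<in>V \<inter> W. \<forall>v. F (\<phi> (x, v)) = \<psi> (x, h x *v v)))"

definition vb_isomorphic ::
  "('e, 'x::euclidean_space, 'd::finite) vbundle \<Rightarrow> ('f, 'x, 'd) vbundle \<Rightarrow> bool" where
  "vb_isomorphic A B \<longleftrightarrow>
     (\<exists>F G. vb_hom A B F \<and> vb_hom B A G \<and>
        (\<forall>e\<in>topspace (total A). G (F e) = e) \<and> (\<forall>e\<in>topspace (total B). F (G e) = e))"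

definition product_bundle ::
  "'x::euclidean_space set \<Rightarrow> ('x \<times> (real^'d::finite), 'x, 'd) vbundle" where
  "product_bundle U =
     \<lparr> total = top_of_set (U \<times> UNIV), proj = fst, trivs = {(U, \<lambda>p. p)} \<rparr>"

definition vb_restrict :: "('e, 'x, 'd::finite) vbundle \<Rightarrow> 'x set \<Rightarrow> ('e, 'x, 'd) vbundle" where
  "vb_restrict A U =
     \<lparr> total = subtopology (total A) {e. proj A e \<in> U},
       proj = proj A,
       trivs = {(V \<inter> U, \<phi>) | V \<phi>. (V, \<phi>) \<in> trivs A} \<rparr>"

text \<open>The restriction of \<open>A\<close> to \<open>U\<close> is trivial.\<close>

definition trivial_over :: "('e, 'x::euclidean_space, 'd::finite) vbundle \<Rightarrow> 'x set \<Rightarrow> bool" where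
  "trivial_over A U \<longleftrightarrow> vb_isomorphic (product_bundle U) (vb_restrict A U)"

section \<open>The tangent bundle of an embedded manifold\<close>

definition tangent_space :: "'a::euclidean_space set \<Rightarrow> 'a \<Rightarrow> 'a set" where
  "tangent_space M x =
     {w. \<exists>\<gamma> \<epsilon>::real. \<epsilon> > 0 \<and> smooth_on {-\<epsilon><..<\<epsilon>} \<gamma> \<and> \<gamma> ` {-\<epsilon><..<\<epsilon>} \<subseteq> M \<and>
            \<gamma> 0 = x \<and> (\<gamma> has_vector_derivative w) (at 0)}"

text \<open>A chart \<open>E\<close> of \<open>M\<close> with inverse \<open>D\<close> trivialises the tangent bundle by
  \<open>(x, v) \<mapsto> (x, dD\<^bsub>E x\<^esub> v)\<close>.\<close>

definition tangent_bundle ::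
  "(real^'N) set \<Rightarrow> ((real^'N) \<times> (real^'N), real^'N, 'd::finite) vbundle" where
  "tangent_bundle M =
     \<lparr> total = top_of_set (Sigma M (tangent_space M)),
       proj = fst,
       trivs = {(V, \<lambda>(x, v). (x, frechet_derivative D (at (E x) within W) v)) | V W E D.
                  openin (top_of_set M) V \<and> open W \<and> diffeomorphism V W E D} \<rparr>"

section \<open>Autoencoder atlases\<close>

text \<open>The latent set \<open>Z\<close> is the domain of the decoder; it may be larger than the image of the
  encoder.\<close>

definition smooth_ae_chart ::
  "(real^'N) set \<Rightarrow> (real^'N) set \<Rightarrow> (real^'N \<Rightarrow> real^'d) \<Rightarrow> (real^'d \<Rightarrow> real^'N) \<Rightarrow> bool" where
  "smooth_ae_chart M U E D \<longleftrightarrow>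
     openin (top_of_set M) U \<and>
     (\<exists>G. diffeomorphism U (E ` U) E G) \<and>
     (\<exists>Z. E ` U \<subseteq> Z \<and> smooth_on Z D \<and> D ` Z \<subseteq> M) \<and>
     (\<forall>x\<in>U. D (E x) = x)"

definition smooth_ae_atlas ::
  "(real^'N) set \<Rightarrow> nat \<Rightarrow> (nat \<Rightarrow> (real^'N) set) \<Rightarrow> (nat \<Rightarrow> real^'N \<Rightarrow> real^'d) \<Rightarrow>
   (nat \<Rightarrow> real^'d \<Rightarrow> real^'N) \<Rightarrow> bool" where
  "smooth_ae_atlas M n U E D \<longleftrightarrow>
     (\<forall>i\<in>{1..n}. smooth_ae_chart M (U i) (E i) (D i)) \<and> (\<Union>i\<in>{1..n}. U i) = M"

text \<open>\<open>ae_cocycle U E D j i x\<close> is $g_{ji}(x) = d(E_j \circ D_i)_{E_i(x)}$.\<close>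

definition ae_cocycle ::
  "(nat \<Rightarrow> (real^'N) set) \<Rightarrow> (nat \<Rightarrow> real^'N \<Rightarrow> real^'d) \<Rightarrow> (nat \<Rightarrow> real^'d \<Rightarrow> real^'N) \<Rightarrow>
   nat \<Rightarrow> nat \<Rightarrow> real^'N \<Rightarrow> real^'d^'d" where
  "ae_cocycle U E D j i x = jacobian (E j \<circ> D i) (at (E i x) within E i ` (U i \<inter> U j))"

definition ae_rel ::
  "nat \<Rightarrow> (nat \<Rightarrow> (real^'N) set) \<Rightarrow> (nat \<Rightarrow> real^'N \<Rightarrow> real^'d) \<Rightarrow> (nat \<Rightarrow> real^'d \<Rightarrow> real^'N) \<Rightarrow>
   ((nat \<times> (real^'N) \<times> (real^'d)) \<times> (nat \<times> (real^'N) \<times> (real^'d))) set" where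
  "ae_rel n U E D =
     {((i, x, v), (j, x, ae_cocycle U E D j i x *v v)) | i j x v.
        i \<in> {1..n} \<and> j \<in> {1..n} \<and> x \<in> U i \<inter> U j}"

definition quotient_topology :: "'a topology \<Rightarrow> ('a \<times> 'a) set \<Rightarrow> 'a set topology" where
  "quotient_topology X r =
     topology (\<lambda>\<S>. \<S> \<subseteq> topspace X // r \<and> openin X {p \<in> topspace X. r `` {p} \<in> \<S>})"

lemma istopology_quotient:
  "istopology (\<lambda>\<S>. \<S> \<subseteq> topspace X // r \<and> openin X {p \<in> topspace X. r `` {p} \<in> \<S>})"
  unfolding istopology_def
proof (intro conjI allI impI)
  fix \<S> \<T>
  assume "\<S> \<subseteq> topspace X // r \<and> openin X {p \<in> topspace X. r `` {p} \<in> \<S>}"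
    and "\<T> \<subseteq> topspace X // r \<and> openin X {p \<in> topspace X. r `` {p} \<in> \<T>}"
  moreover have "{p \<in> topspace X. r `` {p} \<in> \<S> \<inter> \<T>} =
      {p \<in> topspace X. r `` {p} \<in> \<S>} \<inter> {p \<in> topspace X. r `` {p} \<in> \<T>}"
    by auto
  ultimately show "\<S> \<inter> \<T> \<subseteq> topspace X // r"
    and "openin X {p \<in> topspace X. r `` {p} \<in> \<S> \<inter> \<T>}"
    by auto
next
  fix \<K>
  assume *: "\<forall>\<S>\<in>\<K>. \<S> \<subseteq> topspace X // r \<and> openin X {p \<in> topspace X. r `` {p} \<in> \<S>}"
  then show "\<Union>\<K> \<subseteq> topspace X // r"
    by blast
  have "{p \<in> topspace X. r `` {p} \<in> \<Union>\<K>} = (\<Union>\<S>\<in>\<K>. {p \<in> topspace X. r `` {p} \<in> \<S>})"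
    by auto
  with * show "openin X {p \<in> topspace X. r `` {p} \<in> \<Union>\<K>}"
    by auto
qed

lemma openin_quotient_topology:
  "openin (quotient_topology X r) \<S> \<longleftrightarrow>
     \<S> \<subseteq> topspace X // r \<and> openin X {p \<in> topspace X. r `` {p} \<in> \<S>}"
  unfolding quotient_topology_def by (simp add: topology_inverse'[OF istopology_quotient])

definition ae_tangent_bundle ::
  "nat \<Rightarrow> (nat \<Rightarrow> (real^'N) set) \<Rightarrow> (nat \<Rightarrow> real^'N \<Rightarrow> real^'d) \<Rightarrow> (nat \<Rightarrow> real^'d \<Rightarrow> real^'N) \<Rightarrow>
   ((nat \<times> (real^'N) \<times> (real^'d)) set, real^'N, 'd) vbundle" where
  "ae_tangent_bundle n U E D =
     \<lparr> total = quotient_topology (sum_topology (\<lambda>i. top_of_set (U i \<times> UNIV)) {1..n})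
                 (ae_rel n U E D),
       proj = (\<lambda>c. THE x. \<exists>i v. (i, x, v) \<in> c),
       trivs = {(U i, \<lambda>(x, v). ae_rel n U E D `` {(i, x, v)}) | i. i \<in> {1..n}} \<rparr>"

end

theory Submission
  imports Defs
begin

text \<open>For a chart \<open>(E, D)\<close> of \<open>M\<close> with open image, \<open>(x, v) \<mapsto> (x, dD\<^bsub>E x\<^esub> v)\<close> is a homeomorphism onto the
  restriction of \<open>TM\<close> to the chart domain. Its inverse is \<open>(x, w) \<mapsto> (x, de\<^bsub>x\<^esub> w)\<close> for any local smooth
  extension \<open>e\<close> of \<open>E\<close> to the ambient space, because \<open>e \<circ> D\<close> is the identity near \<open>E x\<close>. Two such
  parametrisations differ by the Jacobian of \<open>E' \<circ> D\<close>, which is exactly the cocycle of the atlas.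
  Hence the relation gluing the pieces \<open>U\<^sub>i \<times> \<real>\<^sup>d\<close> is the kernel of the joint parametrisation of \<open>TM\<close>,
  and the two bundles are isomorphic. For the converse, invariance of domain shows that the encoders
  have open images, so that they are charts of \<open>M\<close>.\<close>

section \<open>Calculus of \<open>C\<^sup>k\<close> maps\<close>

text \<open>Derivatives at a point of an open set depend only on nearby values, so equality on
  \<open>W\<close> passes to all derivatives. The induction generalises \<open>f\<close> and
  \<open>g\<close> because its step moves on to \<open>frechet_derivative\<close>.\<close>

lemma Ck_on_cong:
  assumes "open W" and "\<And>x. x \<in> W \<Longrightarrow> f x = g x"
  shows "Ck_on k W f \<longleftrightarrow> Ck_on k W g"
  using assms(2)
proof (induction k arbitrary: f g)
  case 0
  then show ?case
    by (simp cong: continuous_on_cong)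
next
  case (Suc k)
  have 1: "f differentiable (at x) \<longleftrightarrow> g differentiable (at x)" if "x \<in> W" for x
    using has_derivative_transform_within_open[OF _ \<open>open W\<close> that] Suc.prems
    unfolding differentiable_def by metis
  have 2: "frechet_derivative f (at x) = frechet_derivative g (at x)"
    if "x \<in> W" "f differentiable (at x)" for x
    using frechet_derivative_transform_within_open[OF that(2) \<open>open W\<close> that(1)] Suc.prems by blast
  show ?case
  \<comment> \<open>Fact 2 compares derivatives only where \<open>f\<close> is differentiable; if
    \<open>f\<close> fails to be so somewhere on \<open>W\<close>, then \<open>g\<close> fails too
    and both sides are false.\<close>
  proof (cases "\<forall>x\<in>W. f differentiable (at x)")
    case True
    then have "Ck_on k W (\<lambda>x. frechet_derivative f (at x) v) \<longleftrightarrow>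
        Ck_on k W (\<lambda>x. frechet_derivative g (at x) v)" for v
      by (intro Suc.IH) (simp add: 2)
    with 1 show ?thesis by simp
  next
    case False
    with 1 show ?thesis by auto
  qed
qed

text \<open>Lets an explicit derivative \<open>f'\<close> replace the choice-based
  \<open>frechet_derivative\<close> of the recursion; the sum, product and chain rules below enter
  their inductions through it.\<close>

lemma Ck_on_SucI:
  assumes "open W" and "\<And>x. x \<in> W \<Longrightarrow> (f has_derivative f' x) (at x)"
    and "\<And>v. Ck_on k W (\<lambda>x. f' x v)"
  shows "Ck_on (Suc k) W f"
proof -
  have "Ck_on k W (\<lambda>x. frechet_derivative f (at x) v)" for v
    using assms(3)[of v]
    by (subst Ck_on_cong[where g="\<lambda>x. f' x v"]) (simp_all add: assms(1) frechet_derivative_at[OF assms(2), symmetric])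
  with assms(2) show ?thesis
    by (auto simp: differentiable_def)
qed

text \<open>\<open>Ck_on\<close> records continuity only for the derivatives of highest order; for
  lower orders it comes from differentiability.\<close>

lemma Ck_on_SucD:
  assumes "Ck_on (Suc k) W f"
  shows "Ck_on k W f"
  using assms
proof (induction k arbitrary: f)
  case 0
  then show ?case
    by (simp add: continuous_at_imp_continuous_on differentiable_imp_continuous_within)
next
  case (Suc k)
  show ?case
    unfolding Ck_on.simps(2)[of k]
  proof (intro conjI allI)
    show "\<forall>x\<in>W. f differentiable (at x)"
      using Suc.prems unfolding Ck_on.simps(2)[of "Suc k"] by blast
    show "Ck_on k W (\<lambda>x. frechet_derivative f (at x) v)" for v
      using Suc.prems unfolding Ck_on.simps(2)[of "Suc k"] by (blast intro: Suc.IH)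
  qed
qed

lemma Ck_on_imp_continuous_on: "Ck_on k W f \<Longrightarrow> continuous_on W f"
  by (induction k) (auto dest: Ck_on_SucD simp del: Ck_on.simps(2))

lemma Ck_on_subset: "Ck_on k W f \<Longrightarrow> V \<subseteq> W \<Longrightarrow> Ck_on k V f"
  by (induction k arbitrary: f) (auto intro: continuous_on_subset)

lemma Ck_on_local:
  assumes "open W"
    and "\<And>x. x \<in> W \<Longrightarrow> \<exists>V. open V \<and> x \<in> V \<and> Ck_on k V f"
  shows "Ck_on k W f"
  using assms(2)
proof (induction k arbitrary: f)
  case 0
  have "isCont f x" if "x \<in> W" for x
    using 0[OF that] by (auto simp: continuous_on_eq_continuous_at)
  then show ?case
    by (simp add: continuous_at_imp_continuous_on)
next
  case (Suc k)
  have "f differentiable (at x)" if "x \<in> W" for x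
    using Suc.prems[OF that] by auto
  moreover have "Ck_on k W (\<lambda>x. frechet_derivative f (at x) v)" for v
  proof (rule Suc.IH)
    fix x assume "x \<in> W"
    from Suc.prems[OF this]
    show "\<exists>V. open V \<and> x \<in> V \<and> Ck_on k V (\<lambda>x. frechet_derivative f (at x) v)"
      by auto
  qed
  ultimately show ?case by simp
qed

lemma Ck_on_const: "Ck_on k W (\<lambda>x. c)"
  by (induction k arbitrary: c) auto

lemma Ck_on_bounded_linear:
  assumes "open W" "bounded_linear L"
  shows "Ck_on k W L"
proof (cases k)
  case 0
  then show ?thesis
    using assms(2) by (simp add: linear_continuous_on)
next
  case (Suc j)
  have "(L has_derivative L) (at x)" for x
    using bounded_linear.has_derivative[OF assms(2) has_derivative_ident] .
  then show ?thesis
    unfolding Suc by (intro Ck_on_SucI[where f'="\<lambda>_. L"]) (auto simp: assms Ck_on_const)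
qed

lemma Ck_on_bounded_linear_comp:
  assumes "open W" "bounded_linear L" "Ck_on k W f"
  shows "Ck_on k W (\<lambda>x. L (f x))"
  using assms(3)
proof (induction k arbitrary: f)
  case 0
  then show ?case
    using assms(2) by (simp add: bounded_linear.continuous_on)
next
  case (Suc k)
  show ?case
  proof (rule Ck_on_SucI[OF \<open>open W\<close>])
    show "((\<lambda>x. L (f x)) has_derivative (\<lambda>v. L (frechet_derivative f (at x) v))) (at x)"
      if "x \<in> W" for x
      using Suc.prems that
      by (auto intro!: bounded_linear.has_derivative[OF assms(2)] simp: frechet_derivative_works)
  qed (use Suc in auto)
qed

lemma Ck_on_add:
  assumes "open W" "Ck_on k W f" "Ck_on k W g"
  shows "Ck_on k W (\<lambda>x. f x + g x)"
  using assms(2,3)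
proof (induction k arbitrary: f g)
  case 0
  then show ?case by (simp add: continuous_on_add)
next
  case (Suc k)
  show ?case
  proof (rule Ck_on_SucI[OF \<open>open W\<close>])
    show "((\<lambda>x. f x + g x) has_derivative
        (\<lambda>v. frechet_derivative f (at x) v + frechet_derivative g (at x) v)) (at x)"
      if "x \<in> W" for x
      using Suc.prems that by (auto intro!: has_derivative_add simp: frechet_derivative_works)
  qed (use Suc in auto)
qed

lemma Ck_on_sum:
  assumes "open W" "\<And>i. i \<in> I \<Longrightarrow> Ck_on k W (f i)"
  shows "Ck_on k W (\<lambda>x. \<Sum>i\<in>I. f i x)"
  using assms(2)
  by (induction I rule: infinite_finite_induct) (auto simp: Ck_on_const Ck_on_add assms(1))

lemma Ck_on_scaleR:
  assumes "open W" "Ck_on k W f" "Ck_on k W g"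
  shows "Ck_on k W (\<lambda>x. f x *\<^sub>R g x)"
  using assms(2,3)
proof (induction k arbitrary: f g)
  case 0
  then show ?case by (simp add: continuous_on_scaleR)
next
  case (Suc k)
  show ?case
  proof (rule Ck_on_SucI[OF \<open>open W\<close>])
    show "((\<lambda>x. f x *\<^sub>R g x) has_derivative
        (\<lambda>v. f x *\<^sub>R frechet_derivative g (at x) v + frechet_derivative f (at x) v *\<^sub>R g x)) (at x)"
      if "x \<in> W" for x
      using Suc.prems that by (auto intro!: has_derivative_scaleR simp: frechet_derivative_works)
    \<comment> \<open>The product rule also contains \<open>f\<close> and \<open>g\<close>
      undifferentiated, and \<open>Ck_on_SucD\<close> lowers them to order \<open>k\<close>.\<close>
    show "Ck_on k W (\<lambda>x. f x *\<^sub>R frechet_derivative g (at x) v + frechet_derivative f (at x) v *\<^sub>R g x)"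
      for v
      using Suc.prems Ck_on_SucD[OF Suc.prems(1)] Ck_on_SucD[OF Suc.prems(2)]
      by (intro Ck_on_add Suc.IH) (auto simp: \<open>open W\<close>)
  qed
qed

text \<open>\<open>Ck_on\<close> speaks of derivatives in fixed directions; this expansion reduces a
  derivative in a varying direction to finitely many fixed ones.\<close>

lemma linear_eq_sum_Basis:
  fixes L :: "'a::euclidean_space \<Rightarrow> 'b::real_normed_vector"
  assumes "linear L"
  shows "L v = (\<Sum>b\<in>Basis. (v \<bullet> b) *\<^sub>R L b)"
proof -
  have "L v = L (\<Sum>b\<in>Basis. (v \<bullet> b) *\<^sub>R b)"
    by (simp add: euclidean_representation)
  then show ?thesis
    by (simp add: linear_sum[OF assms] linear_scale[OF assms])
qed

text \<open>In the chain rule \<open>f\<close> is differentiated in the direction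
  \<open>?g' x v\<close>, which moves with \<open>x\<close>. Expanding along \<open>Basis\<close>
  leaves scalar C^k coefficients times derivatives of \<open>f\<close> in fixed directions composed
  with \<open>g\<close>, and to these the induction hypothesis applies.\<close>

lemma Ck_on_compose:
  fixes f :: "'b::euclidean_space \<Rightarrow> 'c::real_normed_vector" and g :: "'a::euclidean_space \<Rightarrow> 'b"
  assumes "open W" "open T" "g ` W \<subseteq> T" "Ck_on k T f" "Ck_on k W g"
  shows "Ck_on k W (\<lambda>x. f (g x))"
  using assms(4,5)
proof (induction k arbitrary: f)
  case 0
  with assms(3) show ?case by (auto intro: continuous_on_compose2)
next
  case (Suc k)
  let ?f' = "\<lambda>x. frechet_derivative f (at x)" and ?g' = "\<lambda>x. frechet_derivative g (at x)"
  have T: "g x \<in> T" if "x \<in> W" for x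
    using that assms(3) by blast
  show ?case
  proof (rule Ck_on_SucI[OF \<open>open W\<close>])
    fix x assume x: "x \<in> W"
    have "(f has_derivative ?f' (g x)) (at (g x))" and "(g has_derivative ?g' x) (at x)"
      using Suc.prems T x by (auto simp: frechet_derivative_works)
    moreover from this(1) have "?f' (g x) (?g' x v) = (\<Sum>b\<in>Basis. (?g' x v \<bullet> b) *\<^sub>R ?f' (g x) b)" for v
      by (intro linear_eq_sum_Basis has_derivative_linear)
    moreover have "((\<lambda>x. f (g x)) has_derivative (\<lambda>v. ?f' (g x) (?g' x v))) (at x)"
      using diff_chain_at[OF calculation(2,1)] by (simp add: o_def)
    ultimately show
      "((\<lambda>x. f (g x)) has_derivative (\<lambda>v. \<Sum>b\<in>Basis. (?g' x v \<bullet> b) *\<^sub>R ?f' (g x) b)) (at x)"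
      by presburger
  next
    fix v
    have "Ck_on k W (\<lambda>x. ?g' x v \<bullet> b)" for b
      using Suc.prems(2) by (intro Ck_on_bounded_linear_comp[OF \<open>open W\<close> bounded_linear_inner_left]) simp
    moreover have "Ck_on k W (\<lambda>x. ?f' (g x) b)" for b
      using Suc.prems(1) Ck_on_SucD[OF Suc.prems(2)] by (intro Suc.IH) simp_all
    ultimately show "Ck_on k W (\<lambda>x. \<Sum>b\<in>Basis. (?g' x v \<bullet> b) *\<^sub>R ?f' (g x) b)"
      by (intro Ck_on_sum Ck_on_scaleR \<open>open W\<close>)
  qed
qed

text \<open>Continuity in \<open>x\<close> for each basis direction gives joint continuity by
  linearity in \<open>v\<close>. This is what makes fibrewise derivatives continuous on total
  spaces.\<close>

lemma continuous_on_frechet_derivative: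
  fixes f :: "'a::euclidean_space \<Rightarrow> 'b::real_normed_vector"
  assumes "Ck_on (Suc 0) W f"
  shows "continuous_on (W \<times> UNIV) (\<lambda>(x, v). frechet_derivative f (at x) v)"
proof -
  have "continuous_on W (\<lambda>x. frechet_derivative f (at x) b)" for b
    using assms by simp
  then have "continuous_on (W \<times> UNIV)
      (\<lambda>(x, v::'a). \<Sum>b\<in>Basis. (v \<bullet> b) *\<^sub>R frechet_derivative f (at x) b)"
    unfolding case_prod_unfold
    by (intro continuous_intros continuous_on_compose2[of W _ _ fst]) auto
  moreover have "frechet_derivative f (at x) v = (\<Sum>b\<in>Basis. (v \<bullet> b) *\<^sub>R frechet_derivative f (at x) b)"
    if "x \<in> W" for x v
    using assms that by (intro linear_eq_sum_Basis linear_frechet_derivative) simp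
  ultimately show ?thesis
    by (subst continuous_on_cong[OF refl]) auto
qed

section \<open>Smooth maps on open sets and on arbitrary subsets\<close>

definition Cinf_on where "Cinf_on W f \<longleftrightarrow> open W \<and> (\<forall>k. Ck_on k W f)"

lemma Cinf_on_imp_smooth_on: "Cinf_on W f \<Longrightarrow> S \<subseteq> W \<Longrightarrow> smooth_on S f"
  unfolding Cinf_on_def smooth_on_def by blast

text \<open>Near a point of an open \<open>W\<close> a local extension coincides with
  \<open>f\<close> on a full neighbourhood, so \<open>f\<close> itself is C^k there.\<close>

lemma smooth_on_open_iff: "open W \<Longrightarrow> smooth_on W f \<longleftrightarrow> Cinf_on W f"
proof
  assume W: "open W" and f: "smooth_on W f"
  have "Ck_on k W f" for k
  proof (rule Ck_on_local[OF W])
    fix x assume "x \<in> W"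
    then obtain V g where V: "open V" "x \<in> V" "Ck_on k V g" "\<forall>y\<in>V \<inter> W. g y = f y"
      using f unfolding smooth_on_def by blast
    have "Ck_on k (V \<inter> W) g"
      using V by (auto intro: Ck_on_subset)
    then have "Ck_on k (V \<inter> W) f"
      using V W by (subst Ck_on_cong[where g=g]) auto
    then show "\<exists>V. open V \<and> x \<in> V \<and> Ck_on k V f"
      using V(1,2) W \<open>x \<in> W\<close> by (intro exI[of _ "V \<inter> W"]) auto
  qed
  with W show "Cinf_on W f"
    by (simp add: Cinf_on_def)
qed (auto intro: Cinf_on_imp_smooth_on)

lemma smooth_on_subset:
  assumes "smooth_on S f" "T \<subseteq> S"
  shows "smooth_on T f"
  unfolding smooth_on_def
proof
  fix x assume "x \<in> T"
  then have "x \<in> S"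
    using assms(2) by blast
  then obtain W g where W: "open W" "x \<in> W" "\<forall>k. Ck_on k W g" and eq: "\<forall>y\<in>W \<inter> S. g y = f y"
    using assms(1)[unfolded smooth_on_def] by metis
  have "\<forall>y\<in>W \<inter> T. g y = f y"
    using eq assms(2) by blast
  with W show "\<exists>W g. open W \<and> x \<in> W \<and> (\<forall>k. Ck_on k W g) \<and> (\<forall>y\<in>W \<inter> T. g y = f y)"
    by metis
qed

lemma smooth_on_extension:
  assumes "smooth_on S f" "x \<in> S"
  obtains W g where "Cinf_on W g" "x \<in> W" "\<And>y. y \<in> W \<inter> S \<Longrightarrow> g y = f y"
  using assms unfolding smooth_on_def Cinf_on_def by metis

lemma Cinf_on_differentiable: "Cinf_on W f \<Longrightarrow> x \<in> W \<Longrightarrow> f differentiable (at x)"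
  unfolding Cinf_on_def using Ck_on.simps(2) by blast

lemma Cinf_on_frechet_derivative: "Cinf_on W f \<Longrightarrow> Cinf_on W (\<lambda>x. frechet_derivative f (at x) v)"
  unfolding Cinf_on_def using Ck_on.simps(2) by blast

lemma Cinf_on_imp_continuous_on: "Cinf_on W f \<Longrightarrow> continuous_on W f"
  unfolding Cinf_on_def using Ck_on_imp_continuous_on by blast

lemma continuous_on_local:
  fixes f :: "'a::t2_space \<Rightarrow> 'b::topological_space"
  assumes "\<And>x. x \<in> S \<Longrightarrow> \<exists>W. open W \<and> x \<in> W \<and> continuous_on (W \<inter> S) f"
  shows "continuous_on S f"
  unfolding continuous_on_eq_continuous_within
proof
  fix x assume x: "x \<in> S"
  then obtain W where W: "open W" "x \<in> W" "continuous_on (W \<inter> S) f"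
    using assms by blast
  have "continuous (at x within (W \<inter> S)) f"
    using x W by (simp add: continuous_on_eq_continuous_within)
  moreover have "at x within (W \<inter> S) = at x within S"
    using W by (intro at_within_nhd[of _ W]) auto
  ultimately show "continuous (at x within S) f"
    by simp
qed

lemma smooth_on_imp_continuous_on:
  assumes "smooth_on S f"
  shows "continuous_on S f"
proof (rule continuous_on_local)
  fix x assume x: "x \<in> S"
  obtain W g where g: "Cinf_on W g" "x \<in> W" "\<And>y. y \<in> W \<inter> S \<Longrightarrow> g y = f y"
    using smooth_on_extension[OF assms x] by blast
  have "continuous_on (W \<inter> S) f"
    by (rule continuous_on_eq[OF continuous_on_subset[OF Cinf_on_imp_continuous_on[OF g(1)]]])
      (use g(3) in auto)
  with g show "\<exists>W. open W \<and> x \<in> W \<and> continuous_on (W \<inter> S) f"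
    by (auto simp: Cinf_on_def)
qed

lemma smooth_on_compose:
  fixes f :: "'a::euclidean_space \<Rightarrow> 'b::euclidean_space"
  assumes f: "smooth_on S f" and g: "smooth_on T g" and im: "f ` S \<subseteq> T"
  shows "smooth_on S (\<lambda>x. g (f x))"
  unfolding smooth_on_def
proof
  fix x assume x: "x \<in> S"
  obtain W f' where f': "Cinf_on W f'" "x \<in> W" "\<And>y. y \<in> W \<inter> S \<Longrightarrow> f' y = f y"
    using smooth_on_extension[OF f x] by blast
  have "f x \<in> T"
    using im x by blast
  from smooth_on_extension[OF g this]
  obtain V g' where g': "Cinf_on V g'" "f x \<in> V" "\<And>y. y \<in> V \<inter> T \<Longrightarrow> g' y = g y"
    by blast
  have op: "open W" "open V"
    using f'(1) g'(1) by (auto simp: Cinf_on_def)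
  \<comment> \<open>The two extensions can be composed only where \<open>f'\<close> lands in
    \<open>V\<close>; this set is open, and it contains \<open>x\<close> because
    \<open>f' x = f x\<close>.\<close>
  let ?O = "W \<inter> f' -` V"
  have O: "open ?O"
    using continuous_open_preimage[OF Cinf_on_imp_continuous_on[OF f'(1)] op] .
  have "Ck_on k ?O (\<lambda>y. g' (f' y))" for k
  proof (rule Ck_on_compose[OF O op(2)])
    show "Ck_on k V g'"
      using g'(1) by (simp add: Cinf_on_def)
    show "Ck_on k ?O f'"
      by (rule Ck_on_subset[of k W f']) (use f'(1) in \<open>auto simp: Cinf_on_def\<close>)
  qed auto
  moreover have "x \<in> ?O"
    using f'(2) f'(3)[of x] g'(2) x by auto
  moreover have "\<forall>y\<in>?O \<inter> S. g' (f' y) = g (f y)"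
  proof
    fix y assume y: "y \<in> ?O \<inter> S"
    then have "f' y = f y" by (intro f'(3)) auto
    with y im show "g' (f' y) = g (f y)" by (auto intro!: g'(3))
  qed
  ultimately show "\<exists>W h. open W \<and> x \<in> W \<and> (\<forall>k. Ck_on k W h) \<and> (\<forall>y\<in>W \<inter> S. h y = g (f y))"
    using O by (intro exI[of _ ?O] exI[of _ "\<lambda>y. g' (f' y)"] conjI allI)
qed

text \<open>A matrix is the sum of its columns, and each column of the Jacobian is a directional
  derivative along some \<open>axis j 1\<close>. The linear map \<open>?col j\<close> puts a vector
  into column \<open>j\<close> and zeros elsewhere.\<close>

lemma Cinf_on_jacobian:
  fixes f :: "real^'m \<Rightarrow> real^'n"
  assumes "Cinf_on W f"
  shows "Cinf_on W (\<lambda>x. jacobian f (at x))"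
proof -
  let ?col = "\<lambda>j (w::real^'n). (\<chi> i k. if k = j then w $ i else 0) :: real^'m^'n"
  have lin: "linear (?col j)" for j
    by (rule linearI) (auto simp: vec_eq_iff)
  have W: "open W" using assms by (simp add: Cinf_on_def)
  have "Ck_on k W (\<lambda>x. \<Sum>j\<in>UNIV. ?col j (frechet_derivative f (at x) (axis j 1)))" for k
  proof (rule Ck_on_sum[OF W])
    fix j
    have "Ck_on k W (\<lambda>x. frechet_derivative f (at x) (axis j 1))"
      using Cinf_on_frechet_derivative[OF assms] by (simp add: Cinf_on_def)
    then show "Ck_on k W (\<lambda>x. ?col j (frechet_derivative f (at x) (axis j 1)))"
      using Ck_on_bounded_linear_comp[OF W, of "?col j"] lin
      by (simp add: linear_conv_bounded_linear)
  qed
  moreover have "jacobian f (at x) = (\<Sum>j\<in>UNIV. ?col j (frechet_derivative f (at x) (axis j 1)))" for x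
    by (simp add: jacobian_def matrix_def vec_eq_iff)
  ultimately show ?thesis
    using W by (simp add: Cinf_on_def)
qed

section \<open>Charts and the tangent bundle\<close>

text \<open>With \<open>real^'d\<close> as model space, these are the data over which
  \<open>trivs\<close> of \<open>tangent_bundle\<close> ranges.\<close>

definition chart ::
  "'a::euclidean_space set \<Rightarrow> 'a set \<Rightarrow> 'b::euclidean_space set \<Rightarrow> ('a \<Rightarrow> 'b) \<Rightarrow> ('b \<Rightarrow> 'a) \<Rightarrow> bool" where
  "chart M V W E D \<longleftrightarrow> openin (top_of_set M) V \<and> open W \<and> diffeomorphism V W E D"

lemma chartD:
  assumes "chart M V W E D"
  shows chart_openin: "openin (top_of_set M) V"
    and chart_open: "open W"
    and chart_smooth: "smooth_on V E"
    and chart_Cinf: "Cinf_on W D"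
    and chart_image: "E ` V = W"
    and chart_inv_image: "D ` W = V"
    and chart_in: "x \<in> V \<Longrightarrow> E x \<in> W"
    and chart_inv_in: "y \<in> W \<Longrightarrow> D y \<in> V"
    and chart_inv: "x \<in> V \<Longrightarrow> D (E x) = x"
    and chart_inv': "y \<in> W \<Longrightarrow> E (D y) = y"
    and chart_subset: "V \<subseteq> M"
  using assms openin_imp_subset unfolding chart_def diffeomorphism_def
  by (blast, blast, blast, metis smooth_on_open_iff, blast, blast, blast, blast, blast, blast, blast)

lemma chart_inv_has_derivative:
  assumes "chart M V W E D" "y \<in> W"
  shows "(D has_derivative frechet_derivative D (at y)) (at y)"
  using Cinf_on_differentiable[OF chart_Cinf[OF assms(1)] assms(2)]
  by (simp add: frechet_derivative_works)

lemma chart_preimage_open: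
  assumes "chart M V W E D" "open T"
  shows "open (W \<inter> D -` T)"
  using continuous_open_preimage[OF Cinf_on_imp_continuous_on[OF chart_Cinf[OF assms(1)]]
      chart_open[OF assms(1)] assms(2)] .

text \<open>\<open>V\<close> is in general not open in the ambient space, so \<open>E\<close> itself
  cannot be differentiated there. A local extension \<open>e\<close> can, and differentiating
  \<open>e \<circ> D\<close>, which is the identity near \<open>E y\<close>, shows that the
  derivative of \<open>e\<close> is a left inverse of that of \<open>D\<close>.\<close>

lemma chart_extension:
  assumes c: "chart M V W E D" and x: "x \<in> V"
  obtains Q e where "Cinf_on Q e" "x \<in> Q" "\<And>y. y \<in> Q \<inter> V \<Longrightarrow> e y = E y"
    "\<And>y v. y \<in> Q \<inter> V \<Longrightarrow> frechet_derivative e (at y) (frechet_derivative D (at (E y)) v) = v"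
proof -
  from smooth_on_extension[OF chart_smooth[OF c] x]
  obtain Q e where e: "Cinf_on Q e" "x \<in> Q" "\<And>y. y \<in> Q \<inter> V \<Longrightarrow> e y = E y"
    by blast
  have "frechet_derivative e (at y) (frechet_derivative D (at (E y)) v) = v"
    if y: "y \<in> Q \<inter> V" for y v
  proof -
    have Ey: "E y \<in> W" and Dy: "D (E y) = y"
      using y chart_in[OF c] chart_inv[OF c] by auto
    have "(e has_derivative frechet_derivative e (at y)) (at (D (E y)))"
      using Cinf_on_differentiable[OF e(1)] y Dy by (simp add: frechet_derivative_works)
    from diff_chain_at[OF chart_inv_has_derivative[OF c Ey] this]
    have "((e \<circ> D) has_derivative frechet_derivative e (at y) \<circ> frechet_derivative D (at (E y))) (at (E y))" .
    moreover have "((e \<circ> D) has_derivative (\<lambda>v. v)) (at (E y))"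
    proof (rule has_derivative_transform_within_open[OF has_derivative_ident])
      show "open (W \<inter> D -` Q)"
        using chart_preimage_open[OF c] e(1) by (simp add: Cinf_on_def)
      show "E y \<in> W \<inter> D -` Q"
        using Ey Dy y by auto
      show "z = (e \<circ> D) z" if "z \<in> W \<inter> D -` Q" for z
        using that e(3)[of "D z"] chart_inv_in[OF c] chart_inv'[OF c] by auto
    qed
    ultimately show ?thesis
      using has_derivative_unique by (metis comp_apply)
  qed
  with e show ?thesis by (rule that)
qed

lemma chart_derivative_inj:
  assumes "chart M V W E D" "x \<in> V"
  shows "inj (frechet_derivative D (at (E x)))"
proof -
  obtain Q e where e: "Cinf_on Q e" "x \<in> Q" "\<And>y. y \<in> Q \<inter> V \<Longrightarrow> e y = E y"
    "\<And>y v. y \<in> Q \<inter> V \<Longrightarrow> frechet_derivative e (at y) (frechet_derivative D (at (E y)) v) = v"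
    by (rule chart_extension[OF assms]) (rule that)
  have "frechet_derivative e (at x) (frechet_derivative D (at (E x)) v) = v" for v
    using e(2) assms(2) by (intro e(4)) simp
  then show ?thesis
    by (rule inj_on_inverseI)
qed

text \<open>A curve in \<open>M\<close> through \<open>x\<close> equals
  \<open>D \<circ> e \<circ> \<gamma>\<close> near time 0, so the chain rule puts its velocity in
  the range. Conversely, each vector of the range is the velocity of the image under
  \<open>D\<close> of a straight line in \<open>W\<close>.\<close>

lemma tangent_space_chart:
  assumes c: "chart M V W E D" and x: "x \<in> V"
  shows "tangent_space M x = range (frechet_derivative D (at (E x)))"
proof (intro equalityI subsetI)
  fix w assume "w \<in> tangent_space M x"
  then obtain \<gamma> and \<epsilon> :: real where curve: "\<epsilon> > 0 \<and> smooth_on {-\<epsilon><..<\<epsilon>} \<gamma> \<and>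
      \<gamma> ` {-\<epsilon><..<\<epsilon>} \<subseteq> M \<and> \<gamma> 0 = x \<and> (\<gamma> has_vector_derivative w) (at 0)"
    unfolding tangent_space_def mem_Collect_eq by (elim exE) (rule that)
  then have \<epsilon>: "\<epsilon> > 0" and \<gamma>: "smooth_on {-\<epsilon><..<\<epsilon>} \<gamma>" "\<gamma> ` {-\<epsilon><..<\<epsilon>} \<subseteq> M" "\<gamma> 0 = x"
    and w: "(\<gamma> has_vector_derivative w) (at 0)"
    by simp_all
  obtain Q e where e: "Cinf_on Q e" "x \<in> Q" "\<And>y. y \<in> Q \<inter> V \<Longrightarrow> e y = E y"
    "\<And>y v. y \<in> Q \<inter> V \<Longrightarrow> frechet_derivative e (at y) (frechet_derivative D (at (E y)) v) = v"
    by (rule chart_extension[OF c x]) (rule that)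
  obtain T where T: "open T" "V = M \<inter> T"
    using chart_openin[OF c] by (auto simp: openin_open)
  have Q: "open Q"
    using e(1) by (simp add: Cinf_on_def)
  \<comment> \<open>At these times the curve lies both in \<open>V\<close> and in the domain of
    \<open>e\<close>; \<open>T\<close> makes the relatively open \<open>V\<close> an open
    condition.\<close>
  let ?I = "{-\<epsilon><..<\<epsilon>} \<inter> \<gamma> -` (Q \<inter> T)"
  have I: "open ?I"
    using smooth_on_imp_continuous_on[OF \<gamma>(1)] Q T(1) by (intro continuous_open_preimage) auto
  have I0: "0 \<in> ?I"
    using \<epsilon> \<gamma>(3) e(2) x T(2) by auto
  have eq: "D (e (\<gamma> t)) = \<gamma> t" if "t \<in> ?I" for t
  proof -
    have "\<gamma> t \<in> Q \<inter> V"
      using that T(2) \<gamma>(2) by auto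
    then show ?thesis
      using e(3) chart_inv[OF c] by auto
  qed
  have ex: "e x = E x"
    using e(2,3) x by blast
  have 1: "(\<gamma> has_derivative (\<lambda>h. h *\<^sub>R w)) (at 0)"
    using w by (simp add: has_vector_derivative_def)
  have 2: "(e has_derivative frechet_derivative e (at x)) (at (\<gamma> 0))"
    using Cinf_on_differentiable[OF e(1,2)] \<gamma>(3) by (simp add: frechet_derivative_works)
  have 3: "(D has_derivative frechet_derivative D (at (E x))) (at ((e \<circ> \<gamma>) 0))"
    using chart_inv_has_derivative[OF c chart_in[OF c x]] ex \<gamma>(3) by simp
  have "((D \<circ> (e \<circ> \<gamma>)) has_derivative
      frechet_derivative D (at (E x)) \<circ> (frechet_derivative e (at x) \<circ> (\<lambda>h. h *\<^sub>R w))) (at 0)"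
    using diff_chain_at[OF diff_chain_at[OF 1 2] 3] .
  then have "(\<gamma> has_derivative
      frechet_derivative D (at (E x)) \<circ> (frechet_derivative e (at x) \<circ> (\<lambda>h. h *\<^sub>R w))) (at 0)"
    by (rule has_derivative_transform_within_open[OF _ I I0]) (simp add: eq)
  \<comment> \<open>Comparing the two derivatives of \<open>\<gamma>\<close> at the increment 1
    exhibits the derivative of \<open>e\<close> along \<open>w\<close> as a preimage of
    \<open>w\<close>.\<close>
  from fun_cong[OF has_derivative_unique[OF 1 this], of 1]
  have "w = frechet_derivative D (at (E x)) (frechet_derivative e (at x) w)"
    by simp
  then show "w \<in> range (frechet_derivative D (at (E x)))"
    by blast
next
  fix w assume "w \<in> range (frechet_derivative D (at (E x)))"
  then obtain v where v: "w = frechet_derivative D (at (E x)) v"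
    by blast
  let ?l = "\<lambda>t::real. E x + t *\<^sub>R v"
  have W: "open W"
    using chart_open[OF c] .
  have Ex: "E x \<in> W"
    using chart_in[OF c x] .
  have "open (?l -` W)"
    using W by (intro open_vimage continuous_intros)
  moreover have "0 \<in> ?l -` W"
    using Ex by simp
  ultimately obtain \<epsilon> where \<epsilon>: "\<epsilon> > 0" "ball 0 \<epsilon> \<subseteq> ?l -` W"
    by (metis open_contains_ball)
  then have I: "{-\<epsilon><..<\<epsilon>} \<subseteq> ?l -` W"
    by (simp add: ball_eq_greaterThanLessThan)
  have "Ck_on k {-\<epsilon><..<\<epsilon>} (\<lambda>t. D (?l t))" for k
  proof (rule Ck_on_compose[OF _ W])
    show "Ck_on k {-\<epsilon><..<\<epsilon>} ?l"
      by (rule Ck_on_add[OF _ Ck_on_const Ck_on_bounded_linear])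
        (simp_all add: bounded_linear_scaleR_left)
    show "Ck_on k W D"
      using chart_Cinf[OF c] by (simp add: Cinf_on_def)
  qed (use I in auto)
  then have "smooth_on {-\<epsilon><..<\<epsilon>} (\<lambda>t. D (?l t))"
    by (intro Cinf_on_imp_smooth_on[of "{-\<epsilon><..<\<epsilon>}"]) (simp_all add: Cinf_on_def)
  moreover have "(\<lambda>t. D (?l t)) ` {-\<epsilon><..<\<epsilon>} \<subseteq> M"
    using I chart_inv_in[OF c] chart_subset[OF c] by blast
  moreover have "((\<lambda>t. D (?l t)) has_vector_derivative w) (at 0)"
  proof -
    have 1: "(?l has_derivative (\<lambda>h. h *\<^sub>R v)) (at 0)"
      by (auto intro!: derivative_eq_intros)
    have 2: "(D has_derivative frechet_derivative D (at (E x))) (at (?l 0))"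
      using chart_inv_has_derivative[OF c Ex] by simp
    have "frechet_derivative D (at (E x)) (h *\<^sub>R v) = h *\<^sub>R w" for h
      using linear_scale[OF has_derivative_linear[OF 2]] v by simp
    with diff_chain_at[OF 1 2] show ?thesis
      by (simp add: has_vector_derivative_def o_def)
  qed
  ultimately show "w \<in> tangent_space M x"
    using \<epsilon>(1) chart_inv[OF c x] unfolding tangent_space_def
    by (intro CollectI exI[of _ "\<lambda>t. D (?l t)"] exI[of _ \<epsilon>] conjI) simp_all
qed

text \<open>\<open>V'\<close> is cut out of \<open>M\<close> by an ambient open \<open>T\<close>,
  and the overlap in coordinates is the part of \<open>W\<close> that \<open>D\<close> maps into
  \<open>T\<close>. On this open set smoothness by extensions is ordinary smoothness.\<close>

lemma chart_overlap:
  assumes c: "chart M V W E D" and c': "chart M V' W' E' D'"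
  shows chart_overlap_open: "open (E ` (V \<inter> V'))"
    and chart_transition_Cinf: "Cinf_on (E ` (V \<inter> V')) (E' \<circ> D)"
proof -
  obtain T where T: "open T" "V' = M \<inter> T"
    using chart_openin[OF c'] by (auto simp: openin_open)
  have eq: "E ` (V \<inter> V') = W \<inter> D -` T"
  proof (intro equalityI subsetI)
    fix y assume "y \<in> E ` (V \<inter> V')"
    then show "y \<in> W \<inter> D -` T"
      using T(2) chart_in[OF c] chart_inv[OF c] by auto
  next
    fix y assume y: "y \<in> W \<inter> D -` T"
    then have "D y \<in> V \<inter> V'"
      using chart_inv_in[OF c] chart_subset[OF c] T(2) by auto
    then show "y \<in> E ` (V \<inter> V')"
      using chart_inv'[OF c] y by (metis IntD1 imageI)
  qed
  then show op: "open (E ` (V \<inter> V'))"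
    using chart_preimage_open[OF c T(1)] by simp
  have "E ` (V \<inter> V') \<subseteq> W"
    using eq by simp
  with chart_Cinf[OF c] have "smooth_on (E ` (V \<inter> V')) D"
    by (rule Cinf_on_imp_smooth_on)
  moreover have "D ` (E ` (V \<inter> V')) \<subseteq> V'"
    using chart_inv[OF c] by auto
  ultimately have "smooth_on (E ` (V \<inter> V')) (\<lambda>y. E' (D y))"
    using smooth_on_compose[OF _ chart_smooth[OF c']] by simp
  with op show "Cinf_on (E ` (V \<inter> V')) (E' \<circ> D)"
    by (simp add: smooth_on_open_iff o_def)
qed

text \<open>On the overlap \<open>D\<close> equals \<open>D' \<circ> (E' \<circ> D)\<close>, so the
  chain rule turns a change of chart into multiplication by a Jacobian. It is smooth in coordinates,
  and pulling back along \<open>E\<close> makes it smooth in \<open>x\<close>.\<close>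

lemma chart_transition:
  fixes E :: "'a::euclidean_space \<Rightarrow> real^'m" and E' :: "'a \<Rightarrow> real^'n"
  assumes c: "chart M V W E D" and c': "chart M V' W' E' D'"
  shows chart_transition_smooth: "smooth_on (V \<inter> V') (\<lambda>x. jacobian (E' \<circ> D) (at (E x)))"
    and chart_transition_derivative: "x \<in> V \<inter> V' \<Longrightarrow> frechet_derivative D (at (E x)) v =
      frechet_derivative D' (at (E' x)) (jacobian (E' \<circ> D) (at (E x)) *v v)"
proof -
  let ?Q = "E ` (V \<inter> V')"
  have "smooth_on ?Q (\<lambda>y. jacobian (E' \<circ> D) (at y))"
    using Cinf_on_jacobian[OF chart_transition_Cinf[OF c c']] by (rule Cinf_on_imp_smooth_on) simp
  then show "smooth_on (V \<inter> V') (\<lambda>x. jacobian (E' \<circ> D) (at (E x)))"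
    by (rule smooth_on_compose[rotated]) (auto intro: smooth_on_subset[OF chart_smooth[OF c]])
  assume x: "x \<in> V \<inter> V'"
  have 1: "((E' \<circ> D) has_derivative (*v) (jacobian (E' \<circ> D) (at (E x)))) (at (E x))"
    using Cinf_on_differentiable[OF chart_transition_Cinf[OF c c']] x
    by (simp add: jacobian_works[symmetric])
  have 2: "(D' has_derivative frechet_derivative D' (at (E' x))) (at ((E' \<circ> D) (E x)))"
    using chart_inv_has_derivative[OF c' chart_in[OF c']] x chart_inv[OF c] by simp
  have "(D has_derivative
      frechet_derivative D' (at (E' x)) \<circ> (*v) (jacobian (E' \<circ> D) (at (E x)))) (at (E x))"
  proof (rule has_derivative_transform_within_open[OF diff_chain_at[OF 1 2] chart_overlap_open[OF c c']])
    show "E x \<in> ?Q" using x by blast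
    show "(D' \<circ> (E' \<circ> D)) y = D y" if "y \<in> ?Q" for y
      using that chart_inv[OF c] chart_inv[OF c'] by auto
  qed
  from frechet_derivative_at[OF this, symmetric]
  show "frechet_derivative D (at (E x)) v =
      frechet_derivative D' (at (E' x)) (jacobian (E' \<circ> D) (at (E x)) *v v)"
    by simp
qed

section \<open>Coordinates on the tangent bundle over a chart\<close>

definition tangent_param :: "('a::euclidean_space \<Rightarrow> 'b::euclidean_space) \<Rightarrow> ('b \<Rightarrow> 'a) \<Rightarrow> 'a \<times> 'b \<Rightarrow> 'a \<times> 'a" where
  "tangent_param E D = (\<lambda>(x, v). (x, frechet_derivative D (at (E x)) v))"

text \<open>Using \<open>inv\<close> avoids choosing an extension of \<open>E\<close>. The value is
  meaningful on tangent vectors over the chart domain, where the derivative of \<open>D\<close> is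
  injective with the tangent space as range.\<close>

definition tangent_coord :: "('a::euclidean_space \<Rightarrow> 'b::euclidean_space) \<Rightarrow> ('b \<Rightarrow> 'a) \<Rightarrow> 'a \<times> 'a \<Rightarrow> 'a \<times> 'b" where
  "tangent_coord E D = (\<lambda>(x, w). (x, inv (frechet_derivative D (at (E x))) w))"

lemma fst_tangent_param [simp]: "fst (tangent_param E D p) = fst p"
  and fst_tangent_coord [simp]: "fst (tangent_coord E D e) = fst e"
  by (simp_all add: tangent_param_def tangent_coord_def case_prod_unfold)

lemma tangent_param_image:
  assumes "chart M V W E D"
  shows "tangent_param E D ` (V \<times> UNIV) = Sigma V (tangent_space M)"
proof -
  have "tangent_param E D ` (V \<times> UNIV) = Sigma V (\<lambda>x. range (frechet_derivative D (at (E x))))"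
    by (auto simp: tangent_param_def)
  also have "\<dots> = Sigma V (tangent_space M)"
    by (intro Sigma_cong refl) (simp add: tangent_space_chart[OF assms])
  finally show ?thesis .
qed

lemma tangent_coord_param:
  assumes "chart M V W E D" "p \<in> V \<times> UNIV"
  shows "tangent_coord E D (tangent_param E D p) = p"
proof -
  have "inj (frechet_derivative D (at (E (fst p))))"
    using assms by (auto intro: chart_derivative_inj)
  then show ?thesis
    by (simp add: tangent_param_def tangent_coord_def case_prod_unfold)
qed

lemma tangent_param_coord:
  assumes "chart M V W E D" "e \<in> Sigma V (tangent_space M)"
  shows "tangent_param E D (tangent_coord E D e) = e"
proof -
  have "snd e \<in> range (frechet_derivative D (at (E (fst e))))"
    using assms(2) tangent_space_chart[OF assms(1), of "fst e"] by auto
  then show ?thesis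
    by (simp add: tangent_param_def tangent_coord_def case_prod_unfold f_inv_into_f)
qed

lemma continuous_on_tangent_param:
  assumes c: "chart M V W E D"
  shows "continuous_on (V \<times> UNIV) (tangent_param E D)"
proof -
  have "continuous_on (W \<times> UNIV) (\<lambda>(y, v). frechet_derivative D (at y) v)"
    using chart_Cinf[OF c] by (intro continuous_on_frechet_derivative) (simp only: Cinf_on_def)
  moreover have "continuous_on (V \<times> UNIV) (\<lambda>p. (E (fst p), snd p))"
    using smooth_on_imp_continuous_on[OF chart_smooth[OF c]]
    by (intro continuous_intros continuous_on_compose2[of V E _ fst]) auto
  moreover have "(\<lambda>p. (E (fst p), snd p)) ` (V \<times> UNIV) \<subseteq> W \<times> UNIV"
    using chart_in[OF c] by auto
  ultimately have "continuous_on (V \<times> UNIV)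
      (\<lambda>p. case (E (fst p), snd p) of (y, v) \<Rightarrow> frechet_derivative D (at y) v)"
    by (rule continuous_on_compose2)
  then show ?thesis
    unfolding tangent_param_def case_prod_unfold by (intro continuous_intros) simp
qed

text \<open>\<open>inv\<close> gives no continuity by itself. Near each base point, however, the map
  agrees on tangent vectors with the derivative of a local extension \<open>e\<close>, which is
  jointly continuous.\<close>

lemma continuous_on_tangent_coord:
  assumes c: "chart M V W E D"
  shows "continuous_on (Sigma V (tangent_space M)) (tangent_coord E D)"
proof (rule continuous_on_local)
  fix p assume "p \<in> Sigma V (tangent_space M)"
  then have p: "fst p \<in> V" by auto
  obtain Q e where e: "Cinf_on Q e" "fst p \<in> Q" "\<And>y. y \<in> Q \<inter> V \<Longrightarrow> e y = E y"
    "\<And>y v. y \<in> Q \<inter> V \<Longrightarrow> frechet_derivative e (at y) (frechet_derivative D (at (E y)) v) = v"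
    by (rule chart_extension[OF c p]) (rule that)
  let ?Q = "Q \<times> (UNIV :: 'a set)"
  have "continuous_on ?Q (\<lambda>(y, w). frechet_derivative e (at y) w)"
    using e(1) by (intro continuous_on_frechet_derivative) (simp only: Cinf_on_def)
  then have "continuous_on ?Q (\<lambda>p. (fst p, (\<lambda>(y, w). frechet_derivative e (at y) w) p))"
    by (intro continuous_intros)
  then have "continuous_on (?Q \<inter> Sigma V (tangent_space M)) (tangent_coord E D)"
  proof (rule continuous_on_eq[OF continuous_on_subset])
    fix q assume q: "q \<in> ?Q \<inter> Sigma V (tangent_space M)"
    obtain x w where xw: "q = (x, w)" by fastforce
    then have x: "x \<in> Q \<inter> V"
      using q by auto
    obtain v where "w = frechet_derivative D (at (E x)) v"
      using q xw x tangent_space_chart[OF c] by auto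
    then show "(fst q, (\<lambda>(y, w). frechet_derivative e (at y) w) q) = tangent_coord E D q"
      using x e(4) chart_derivative_inj[OF c, of x] by (simp add: xw tangent_coord_def)
  qed simp
  then show "\<exists>Q. open Q \<and> p \<in> Q \<and> continuous_on (Q \<inter> Sigma V (tangent_space M)) (tangent_coord E D)"
    using e(1,2) by (intro exI[of _ ?Q]) (auto simp: Cinf_on_def open_Times mem_Times_iff)
qed

text \<open>The trivialisations differentiate within \<open>W\<close>; since \<open>W\<close> is
  open, this is the derivative used in \<open>tangent_param\<close>.\<close>

lemma tangent_bundle_triv:
  assumes "(V, \<phi>) \<in> trivs (tangent_bundle M :: (_, _, 'd::finite) vbundle)"
  obtains W E and D :: "real^'d \<Rightarrow> real^'N"
  where "chart M V W E D" "\<And>x v. x \<in> V \<Longrightarrow> \<phi> (x, v) = tangent_param E D (x, v)"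
proof -
  obtain W E and D :: "real^'d \<Rightarrow> real^'N" where c: "chart M V W E D"
    and \<phi>: "\<phi> = (\<lambda>(x, v). (x, frechet_derivative D (at (E x) within W) v))"
    using assms unfolding tangent_bundle_def chart_def by auto
  have "\<phi> (x, v) = tangent_param E D (x, v)" if "x \<in> V" for x v
    using at_within_open[OF chart_in[OF c that] chart_open[OF c]] by (simp add: \<phi> tangent_param_def)
  then show ?thesis
    by (rule that[OF c])
qed

lemma tangent_param_transition:
  fixes E :: "'a::euclidean_space \<Rightarrow> real^'m" and E' :: "'a \<Rightarrow> real^'n"
  assumes c: "chart M V W E D" and c': "chart M V' W' E' D'"
  obtains h :: "'a \<Rightarrow> real^'m^'n" where "smooth_on (V \<inter> V') h"
    "\<And>x v. x \<in> V \<inter> V' \<Longrightarrow> tangent_param E D (x, v) = tangent_param E' D' (x, h x *v v)"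
proof (rule that[OF chart_transition_smooth[OF c c']])
  show "tangent_param E D (x, v) = tangent_param E' D' (x, jacobian (E' \<circ> D) (at (E x)) *v v)"
    if "x \<in> V \<inter> V'" for x v
    using chart_transition_derivative[OF c c' that] by (simp add: tangent_param_def)
qed

text \<open>The hypothesis gives only a diffeomorphism onto the image. Read through a chart
  \<open>d\<close> of \<open>M\<close>, the encoder becomes a continuous injection from an open
  subset of \<open>real^'d\<close> into \<open>real^'d\<close>; the dimensions agree, so invariance
  of domain applies.\<close>

lemma encoder_image_open:
  fixes E :: "real^'N \<Rightarrow> real^'d"
  assumes M: "smooth_manifold TYPE('d::finite) M" and U: "openin (top_of_set M) U"
    and E: "diffeomorphism U (E ` U) E G"
  shows "open (E ` U)"
proof (subst open_subopen, intro ballI)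
  fix y assume "y \<in> E ` U"
  then obtain x where x: "x \<in> U" "y = E x" by blast
  then have "x \<in> M"
    using openin_imp_subset[OF U] by blast
  then obtain V and W :: "(real^'d) set" and e d where c: "chart M V W e d" and xV: "x \<in> V"
    using M unfolding smooth_manifold_def chart_def diffeomorphic_def by blast
  obtain T where T: "open T" "U = M \<inter> T"
    using U by (auto simp: openin_open)
  \<comment> \<open>This is the part of the coordinate domain that \<open>d\<close> sends into
    \<open>U\<close>, where the encoder is continuous and injective.\<close>
  let ?W = "W \<inter> d -` T"
  have dW: "d ` ?W \<subseteq> U"
    using T(2) chart_inv_in[OF c] chart_subset[OF c] by auto
  have "open ((E \<circ> d) ` ?W)"
  proof (rule invariance_of_domain)
    show "open ?W"
      using chart_preimage_open[OF c T(1)] .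
    have "continuous_on ?W d"
      using continuous_on_subset[OF Cinf_on_imp_continuous_on[OF chart_Cinf[OF c]]] by blast
    moreover have "continuous_on (d ` ?W) E"
      using E dW unfolding diffeomorphism_def
      by (meson continuous_on_subset smooth_on_imp_continuous_on)
    ultimately show "continuous_on ?W (E \<circ> d)"
      by (rule continuous_on_compose)
    have "inj_on E U"
      using E unfolding diffeomorphism_def by (metis inj_onI)
    then have "inj_on E (d ` ?W)"
      using dW by (rule inj_on_subset)
    moreover have "inj_on d ?W"
      using chart_inv'[OF c] by (metis IntD1 inj_onI)
    ultimately show "inj_on (E \<circ> d) ?W"
      by (intro comp_inj_on)
  qed
  moreover have "y \<in> (E \<circ> d) ` ?W"
  proof
    show "e x \<in> ?W"
      using chart_in[OF c xV] chart_inv[OF c xV] x(1) T(2) by auto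
    show "y = (E \<circ> d) (e x)"
      using chart_inv[OF c xV] x(2) by simp
  qed
  moreover have "(E \<circ> d) ` ?W \<subseteq> E ` U"
    using dW by (auto simp: image_comp[symmetric])
  ultimately show "\<exists>T. open T \<and> y \<in> T \<and> T \<subseteq> E ` U"
    by blast
qed

section \<open>Triviality of the tangent bundle over a chart domain\<close>

lemma tangent_param_continuous_map:
  assumes "chart M V W E D"
  shows "continuous_map (top_of_set (V \<times> UNIV)) (top_of_set (Sigma V (tangent_space M))) (tangent_param E D)"
  using continuous_on_tangent_param[OF assms] tangent_param_image[OF assms]
  by (simp add: continuous_map_in_subtopology image_subset_iff_funcset[symmetric])

lemma tangent_coord_in:
  "e \<in> Sigma V (tangent_space M) \<Longrightarrow> tangent_coord E D e \<in> V \<times> UNIV"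
  by (auto simp: tangent_coord_def)

lemma tangent_coord_continuous_map:
  assumes "chart M V W E D"
  shows "continuous_map (top_of_set (Sigma V (tangent_space M))) (top_of_set (V \<times> UNIV)) (tangent_coord E D)"
proof -
  have "tangent_coord E D \<in> Sigma V (tangent_space M) \<rightarrow> V \<times> UNIV"
    using tangent_coord_in by blast
  with continuous_on_tangent_coord[OF assms] show ?thesis
    by (simp add: continuous_map_in_subtopology)
qed

lemma total_tangent_bundle [simp]: "total (tangent_bundle M) = top_of_set (Sigma M (tangent_space M))"
  and proj_tangent_bundle [simp]: "proj (tangent_bundle M) = fst"
  by (simp_all add: tangent_bundle_def)

lemma tangent_bundle_restrict_total:
  assumes "U \<subseteq> M"
  shows "subtopology (top_of_set (Sigma M (tangent_space M))) {e. fst e \<in> U} =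
    top_of_set (Sigma U (tangent_space M))"
proof -
  have "Sigma M (tangent_space M) \<inter> {e. fst e \<in> U} = Sigma U (tangent_space M)"
    using assms by auto
  then show ?thesis
    by (simp add: subtopology_subtopology)
qed

lemma vb_homI:
  fixes A :: "('e, 'x::euclidean_space, 'd::finite) vbundle" and B :: "('f, 'x, 'd) vbundle"
  assumes "continuous_map (total A) (total B) F"
    and "\<And>e. e \<in> topspace (total A) \<Longrightarrow> proj B (F e) = proj A e"
    and "\<And>V \<phi> W \<psi>. (V, \<phi>) \<in> trivs A \<Longrightarrow> (W, \<psi>) \<in> trivs B \<Longrightarrow>
      \<exists>h :: 'x \<Rightarrow> real^'d^'d. smooth_on (V \<inter> W) h \<and>
        (\<forall>x\<in>V \<inter> W. \<forall>v. F (\<phi> (x, v)) = \<psi> (x, h x *v v))"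
  shows "vb_hom A B F"
  using assms unfolding vb_hom_def by blast

text \<open>Every member of \<open>trivs\<close> comes from a chart. The two parts supply the matrix
  condition of \<open>vb_hom\<close> for the two directions of an isomorphism built from
  \<open>tangent_param\<close>.\<close>

lemma chart_triv_transition:
  fixes E :: "real^'N \<Rightarrow> real^'d::finite"
  assumes c: "chart M U W E D" and V: "(V, \<phi>) \<in> trivs (tangent_bundle M :: (_, _, 'd) vbundle)"
  shows "\<exists>h :: real^'N \<Rightarrow> real^'d^'d. smooth_on (U \<inter> V) h \<and>
      (\<forall>x\<in>U \<inter> V. \<forall>v. tangent_param E D (x, v) = \<phi> (x, h x *v v))"
    and "\<exists>h :: real^'N \<Rightarrow> real^'d^'d. smooth_on (U \<inter> V) h \<and>
      (\<forall>x\<in>U \<inter> V. \<forall>v. \<phi> (x, v) = tangent_param E D (x, h x *v v))"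
proof -
  obtain W' E' and D' :: "real^'d \<Rightarrow> real^'N" where c': "chart M V W' E' D'"
    and \<phi>: "\<And>x v. x \<in> V \<Longrightarrow> \<phi> (x, v) = tangent_param E' D' (x, v)"
    by (rule tangent_bundle_triv[OF V]) (rule that)
  obtain h :: "real^'N \<Rightarrow> real^'d^'d" where h: "smooth_on (U \<inter> V) h"
    "\<And>x v. x \<in> U \<inter> V \<Longrightarrow> tangent_param E D (x, v) = tangent_param E' D' (x, h x *v v)"
    by (rule tangent_param_transition[OF c c']) (rule that)
  show "\<exists>h :: real^'N \<Rightarrow> real^'d^'d. smooth_on (U \<inter> V) h \<and>
      (\<forall>x\<in>U \<inter> V. \<forall>v. tangent_param E D (x, v) = \<phi> (x, h x *v v))"
    using h \<phi> by (intro exI[of _ h]) simp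
  obtain h' :: "real^'N \<Rightarrow> real^'d^'d" where h': "smooth_on (V \<inter> U) h'"
    "\<And>x v. x \<in> V \<inter> U \<Longrightarrow> tangent_param E' D' (x, v) = tangent_param E D (x, h' x *v v)"
    by (rule tangent_param_transition[OF c' c]) (rule that)
  show "\<exists>h :: real^'N \<Rightarrow> real^'d^'d. smooth_on (U \<inter> V) h \<and>
      (\<forall>x\<in>U \<inter> V. \<forall>v. \<phi> (x, v) = tangent_param E D (x, h x *v v))"
    using h' \<phi> by (intro exI[of _ h']) (simp add: Int_commute)
qed

lemma tangent_bundle_trivial_over_chart:
  fixes E :: "real^'N \<Rightarrow> real^'d"
  assumes c: "chart M U W E D"
  shows "trivial_over (tangent_bundle M :: (_, _, 'd::finite) vbundle) U"
proof -
  let ?T = "tangent_bundle M :: (_, _, 'd::finite) vbundle"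
  let ?P = "product_bundle U :: (_, _, 'd) vbundle"
  have T: "total (vb_restrict ?T U) = top_of_set (Sigma U (tangent_space M))"
    "proj (vb_restrict ?T U) = fst"
    "trivs (vb_restrict ?T U) = {(V \<inter> U, \<phi>) | V \<phi>. (V, \<phi>) \<in> trivs ?T}"
    using tangent_bundle_restrict_total[OF chart_subset[OF c]] by (simp_all add: vb_restrict_def)
  have P: "total ?P = top_of_set (U \<times> UNIV)" "proj ?P = fst" "trivs ?P = {(U, \<lambda>p. p)}"
    by (simp_all add: product_bundle_def)
  \<comment> \<open>Trivialisations of the restriction live over \<open>V \<inter> U\<close>; these
    identities reduce their overlaps with \<open>U\<close> to \<open>U \<inter> V\<close>.\<close>
  have Int: "U \<inter> (V \<inter> U) = U \<inter> V" "(V \<inter> U) \<inter> U = U \<inter> V" for V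
    by auto
  have "vb_hom ?P (vb_restrict ?T U) (tangent_param E D)"
  proof (rule vb_homI, goal_cases)
    case 1
    show ?case
      using tangent_param_continuous_map[OF c] by (simp add: T P)
  next
    case (3 A \<phi> B \<psi>)
    then obtain V where A: "A = U" "\<phi> = (\<lambda>p. p)" "B = V \<inter> U" and V: "(V, \<psi>) \<in> trivs ?T"
      unfolding P T by blast
    from chart_triv_transition(1)[OF c V] show ?case
      by (simp add: A Int)
  qed (simp add: T P)
  moreover have "vb_hom (vb_restrict ?T U) ?P (tangent_coord E D)"
  proof (rule vb_homI, goal_cases)
    case 1
    show ?case
      using tangent_coord_continuous_map[OF c] by (simp add: T P)
  next
    case (3 B \<psi> A \<phi>)
    then obtain V where A: "A = U" "\<phi> = (\<lambda>p. p)" "B = V \<inter> U" and V: "(V, \<psi>) \<in> trivs ?T"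
      unfolding P T by blast
    from chart_triv_transition(2)[OF c V] obtain h :: "real^'N \<Rightarrow> real^'d^'d"
      where h: "smooth_on (U \<inter> V) h" "\<forall>x\<in>U \<inter> V. \<forall>v. \<psi> (x, v) = tangent_param E D (x, h x *v v)"
      by blast
    \<comment> \<open>Taking coordinates cancels \<open>tangent_param\<close> in the transition
      formula and leaves the matrix \<open>h x\<close>.\<close>
    have "tangent_coord E D (\<psi> (x, v)) = (x, h x *v v)" if "x \<in> U \<inter> V" for x v
      using h(2) that tangent_coord_param[OF c, of "(x, h x *v v)"] by simp
    with h(1) show ?case
      by (intro exI[of _ h]) (simp add: A Int Int_commute)
  qed (simp add: T P)
  ultimately show ?thesis
    unfolding trivial_over_def vb_isomorphic_def
    using tangent_coord_param[OF c] tangent_param_coord[OF c]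
    by (intro exI[of _ "tangent_param E D"] exI[of _ "tangent_coord E D"]) (simp add: T P)
qed

section \<open>The tangent bundle of an autoencoder atlas\<close>

lemma topspace_quotient_topology: "topspace (quotient_topology X r) = topspace X // r"
proof (rule antisym)
  show "topspace (quotient_topology X r) \<subseteq> topspace X // r"
    using openin_topspace[of "quotient_topology X r"] unfolding openin_quotient_topology by blast
  have "{p \<in> topspace X. r `` {p} \<in> topspace X // r} = topspace X"
    by (auto intro: quotientI)
  then show "topspace X // r \<subseteq> topspace (quotient_topology X r)"
    by (intro openin_subset) (simp add: openin_quotient_topology)
qed

lemma continuous_map_quotient_proj: "continuous_map X (quotient_topology X r) (\<lambda>p. r `` {p})"
  unfolding continuous_map_def topspace_quotient_topology
  by (auto simp: openin_quotient_topology intro: quotientI)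

text \<open>The universal property, for an arbitrary relation \<open>r\<close>: since
  \<open>f\<close> is given on classes, no compatibility of representatives arises, and preimages
  under \<open>f\<close> pull back to preimages under the composite.\<close>

lemma continuous_map_from_quotient:
  assumes "continuous_map X Y (\<lambda>p. f (r `` {p}))"
  shows "continuous_map (quotient_topology X r) Y f"
  unfolding continuous_map_def topspace_quotient_topology
proof (intro conjI allI impI)
  show "f \<in> topspace X // r \<rightarrow> topspace Y"
    using continuous_map_funspace[OF assms] by (auto elim!: quotientE)
  fix T assume "openin Y T"
  then have "openin X {p \<in> topspace X. f (r `` {p}) \<in> T}"
    using assms by (simp add: continuous_map_def)
  moreover have "{p \<in> topspace X. r `` {p} \<in> {c \<in> topspace X // r. f c \<in> T}} =
      {p \<in> topspace X. f (r `` {p}) \<in> T}"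
    by (auto intro: quotientI)
  ultimately show "openin (quotient_topology X r) {c \<in> topspace X // r. f c \<in> T}"
    unfolding openin_quotient_topology by auto
qed

lemma continuous_map_from_sum:
  assumes "\<And>i. i \<in> I \<Longrightarrow> continuous_map (X i) Y (\<lambda>x. f (i, x))"
  shows "continuous_map (sum_topology X I) Y f"
  unfolding continuous_map_def
proof (intro conjI allI impI)
  show "f \<in> topspace (sum_topology X I) \<rightarrow> topspace Y"
    using continuous_map_funspace[OF assms] by fastforce
  fix T assume T: "openin Y T"
  have "openin (X i) {x. (i, x) \<in> {p \<in> topspace (sum_topology X I). f p \<in> T}}" if "i \<in> I" for i
    using openin_continuous_map_preimage[OF assms[OF that] T] that by simp
  then show "openin (sum_topology X I) {p \<in> topspace (sum_topology X I). f p \<in> T}"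
    unfolding openin_sum_topology by auto
qed

section \<open>Gluing the pieces of an atlas of charts\<close>

locale chart_atlas =
  fixes M :: "(real^'N::finite) set" and n :: nat and U :: "nat \<Rightarrow> (real^'N) set"
    and W :: "nat \<Rightarrow> (real^'d::finite) set" and E :: "nat \<Rightarrow> real^'N \<Rightarrow> real^'d"
    and D :: "nat \<Rightarrow> real^'d \<Rightarrow> real^'N"
  assumes chart: "i \<in> {1..n} \<Longrightarrow> chart M (U i) (W i) (E i) (D i)"
    and cover: "(\<Union>i\<in>{1..n}. U i) = M"
begin

abbreviation "pieces \<equiv> sum_topology (\<lambda>i. top_of_set (U i \<times> (UNIV :: (real^'d) set))) {1..n}"

definition param :: "nat \<times> (real^'N) \<times> (real^'d) \<Rightarrow> (real^'N) \<times> (real^'N)" where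
  "param = (\<lambda>(i, p). tangent_param (E i) (D i) p)"

text \<open>These sets turn out to be the classes of \<open>ae_rel\<close>, so this is the map from
  the tangent bundle to the glued bundle.\<close>

definition fibre :: "(real^'N) \<times> (real^'N) \<Rightarrow> (nat \<times> (real^'N) \<times> (real^'d)) set" where
  "fibre e = {q \<in> topspace pieces. param q = e}"

lemma topspace_pieces: "topspace pieces = Sigma {1..n} (\<lambda>i. U i \<times> UNIV)"
  by (simp add: o_def)

text \<open>The cocycle differentiates within the image of the overlap; that image is open, so this
  is the ordinary Jacobian.\<close>

lemma cocycle_eq:
  assumes "i \<in> {1..n}" "j \<in> {1..n}" "x \<in> U i \<inter> U j"
  shows "ae_cocycle U E D j i x = jacobian (E j \<circ> D i) (at (E i x))"
  using at_within_open[OF imageI[OF assms(3)] chart_overlap_open[OF chart chart]] assms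
  by (simp add: ae_cocycle_def)

lemma param_cocycle:
  assumes "i \<in> {1..n}" "j \<in> {1..n}" "x \<in> U i \<inter> U j"
  shows "param (j, x, ae_cocycle U E D j i x *v v) = param (i, x, v)"
  using chart_transition_derivative[OF chart[OF assms(1)] chart[OF assms(2)] assms(3)]
  by (simp add: cocycle_eq[OF assms] param_def tangent_param_def)

text \<open>Glued representatives have equal images by the transition formula. Conversely, equal
  images share a base point, and injectivity of one parametrisation determines the vector. As a
  kernel, the relation is an equivalence without any appeal to cocycle identities.\<close>

lemma ae_rel_iff:
  "(p, q) \<in> ae_rel n U E D \<longleftrightarrow> p \<in> topspace pieces \<and> q \<in> topspace pieces \<and> param p = param q"
proof
  assume "(p, q) \<in> ae_rel n U E D"
  then obtain i j x v where "p = (i, x, v)" "q = (j, x, ae_cocycle U E D j i x *v v)"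
    "i \<in> {1..n}" "j \<in> {1..n}" "x \<in> U i \<inter> U j"
    unfolding ae_rel_def by blast
  then show "p \<in> topspace pieces \<and> q \<in> topspace pieces \<and> param p = param q"
    using param_cocycle by (simp add: topspace_pieces)
next
  assume pq: "p \<in> topspace pieces \<and> q \<in> topspace pieces \<and> param p = param q"
  obtain i x v j y w where p: "p = (i, x, v)" and q: "q = (j, y, w)"
    by (metis prod.exhaust)
  have "fst (param p) = fst (param q)"
    using pq by simp
  then have y: "y = x"
    by (simp add: p q param_def)
  have ij: "i \<in> {1..n}" "j \<in> {1..n}" "x \<in> U i \<inter> U j"
    using pq by (auto simp: p q y topspace_pieces)
  \<comment> \<open>The cocycle moves \<open>v\<close> to piece \<open>j\<close>, so that both
    vectors are compared under the same injective parametrisation.\<close>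
  have "tangent_param (E j) (D j) (x, ae_cocycle U E D j i x *v v) = tangent_param (E j) (D j) (x, w)"
    using param_cocycle[OF ij, of v] pq by (simp add: p q y param_def)
  then have "ae_cocycle U E D j i x *v v = w"
    using tangent_coord_param[OF chart[OF ij(2)]] ij(3) by (metis IntD2 UNIV_I mem_Sigma_iff prod.inject)
  then show "(p, q) \<in> ae_rel n U E D"
    using ij unfolding ae_rel_def p q y by blast
qed

lemma ae_class: "p \<in> topspace pieces \<Longrightarrow> ae_rel n U E D `` {p} = fibre (param p)"
  by (auto simp: ae_rel_iff fibre_def)

lemma param_in:
  assumes "p \<in> topspace pieces"
  shows "param p \<in> Sigma M (tangent_space M)"
proof -
  obtain i x v where p: "p = (i, x, v)" "i \<in> {1..n}" "x \<in> U i"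
    using assms unfolding topspace_pieces by blast
  then have "param p \<in> Sigma (U i) (tangent_space M)"
    using tangent_param_image[OF chart[OF p(2)]] by (auto simp: param_def)
  then show ?thesis
    using chart_subset[OF chart[OF p(2)]] by (metis mem_Sigma_iff subsetD surj_pair)
qed

lemma param_coord:
  assumes "i \<in> {1..n}" "e \<in> Sigma (U i) (tangent_space M)"
  shows "(i, tangent_coord (E i) (D i) e) \<in> topspace pieces"
    and "param (i, tangent_coord (E i) (D i) e) = e"
  using tangent_coord_in[OF assms(2)] tangent_param_coord[OF chart[OF assms(1)] assms(2)] assms(1)
  by (simp_all add: topspace_pieces param_def)

lemma fibre_nonempty:
  assumes "e \<in> Sigma M (tangent_space M)"
  shows "\<exists>p. p \<in> fibre e"
proof -
  obtain i where "i \<in> {1..n}" "e \<in> Sigma (U i) (tangent_space M)"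
    using assms cover by auto
  then show ?thesis
    using param_coord unfolding fibre_def by blast
qed

lemma quotient_pieces: "topspace pieces // ae_rel n U E D = fibre ` Sigma M (tangent_space M)"
proof (intro equalityI subsetI)
  fix c assume "c \<in> topspace pieces // ae_rel n U E D"
  then obtain p where "p \<in> topspace pieces" "c = ae_rel n U E D `` {p}"
    by (rule quotientE)
  then show "c \<in> fibre ` Sigma M (tangent_space M)"
    using ae_class param_in by auto
next
  fix c assume "c \<in> fibre ` Sigma M (tangent_space M)"
  then obtain e where e: "e \<in> Sigma M (tangent_space M)" "c = fibre e"
    by blast
  then obtain p where p: "p \<in> topspace pieces" "param p = e"
    using fibre_nonempty unfolding fibre_def by blast
  then have "c = ae_rel n U E D `` {p}"
    using ae_class e(2) by simp
  with p(1) show "c \<in> topspace pieces // ae_rel n U E D"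
    by (simp add: quotientI)
qed

text \<open>On a class the chosen representative does not matter, since \<open>param\<close> is
  constant on each fibre.\<close>

definition to_tangent :: "(nat \<times> (real^'N) \<times> (real^'d)) set \<Rightarrow> (real^'N) \<times> (real^'N)" where
  "to_tangent c = param (SOME p. p \<in> c)"

lemma to_tangent_fibre:
  assumes "e \<in> Sigma M (tangent_space M)"
  shows "to_tangent (fibre e) = e"
  using someI_ex[OF fibre_nonempty[OF assms]] by (simp add: to_tangent_def fibre_def)

lemma ae_tangent_bundle_simps:
  "total (ae_tangent_bundle n U E D) = quotient_topology pieces (ae_rel n U E D)"
  "proj (ae_tangent_bundle n U E D) = (\<lambda>c. THE x. \<exists>i v. (i, x, v) \<in> c)"
  "trivs (ae_tangent_bundle n U E D) =
    {(U i, \<lambda>(x, v). ae_rel n U E D `` {(i, x, v)}) | i. i \<in> {1..n}}"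
  by (simp_all add: ae_tangent_bundle_def)

text \<open>All elements of a class carry the base point of its tangent vector, and the class is
  nonempty; hence the description in \<open>proj\<close> is well defined.\<close>

lemma proj_fibre:
  assumes "e \<in> Sigma M (tangent_space M)"
  shows "proj (ae_tangent_bundle n U E D) (fibre e) = fst e"
  unfolding ae_tangent_bundle_simps
proof (rule the_equality)
  show "\<exists>i v. (i, fst e, v) \<in> fibre e"
    using fibre_nonempty[OF assms] by (force simp: fibre_def param_def)
  show "x = fst e" if "\<exists>i v. (i, x, v) \<in> fibre e" for x
    using that by (auto simp: fibre_def param_def)
qed

lemma continuous_map_param: "continuous_map pieces (top_of_set (Sigma M (tangent_space M))) param"
proof (rule continuous_map_from_sum)
  fix i assume i: "i \<in> {1..n}"
  have "Sigma (U i) (tangent_space M) \<subseteq> Sigma M (tangent_space M)"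
    using i cover by auto
  with tangent_param_continuous_map[OF chart[OF i]]
  show "continuous_map (top_of_set (U i \<times> UNIV)) (top_of_set (Sigma M (tangent_space M))) (\<lambda>p. param (i, p))"
    by (auto simp: param_def continuous_map_in_subtopology)
qed

text \<open>The parts over the sets \<open>U i\<close> form an open cover of the tangent bundle. On
  each of them \<open>fibre\<close> is the coordinate map into piece \<open>i\<close> followed by
  the quotient map, and the parts are pasted.\<close>

lemma continuous_map_fibre:
  "continuous_map (top_of_set (Sigma M (tangent_space M)))
     (quotient_topology pieces (ae_rel n U E D)) fibre"
proof (rule pasting_lemma[where I="{1..n}" and T="\<lambda>i. Sigma (U i) (tangent_space M)" and f="\<lambda>_. fibre"])
  fix i assume i: "i \<in> {1..n}"
  have sub: "U i \<subseteq> M"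
    using i cover by auto
  obtain T where T: "open T" "U i = M \<inter> T"
    using chart_openin[OF chart[OF i]] by (auto simp: openin_open)
  have "Sigma (U i) (tangent_space M) = Sigma M (tangent_space M) \<inter> (T \<times> UNIV)"
    using T(2) by auto
  then show "openin (top_of_set (Sigma M (tangent_space M))) (Sigma (U i) (tangent_space M))"
    using T(1) by (metis open_Times open_UNIV openin_open_Int)
  have "continuous_map (top_of_set (Sigma (U i) (tangent_space M))) (quotient_topology pieces (ae_rel n U E D))
      ((\<lambda>p. ae_rel n U E D `` {p}) \<circ> (Pair i \<circ> tangent_coord (E i) (D i)))"
    using tangent_coord_continuous_map[OF chart[OF i]] continuous_map_component_injection[OF i]
    by (intro continuous_map_compose[OF _ continuous_map_quotient_proj] continuous_map_compose)
  then have "continuous_map (top_of_set (Sigma (U i) (tangent_space M))) (quotient_topology pieces (ae_rel n U E D)) fibre"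
    by (rule continuous_map_eq) (simp add: ae_class[OF param_coord(1)[OF i]] param_coord(2)[OF i])
  moreover have "Sigma M (tangent_space M) \<inter> Sigma (U i) (tangent_space M) = Sigma (U i) (tangent_space M)"
    using sub by auto
  ultimately show "continuous_map (subtopology (top_of_set (Sigma M (tangent_space M)))
      (Sigma (U i) (tangent_space M))) (quotient_topology pieces (ae_rel n U E D)) fibre"
    by (simp add: subtopology_subtopology)
qed (use cover in auto)

theorem ae_tangent_bundle_isomorphic:
  "vb_isomorphic (ae_tangent_bundle n U E D) (tangent_bundle M)"
proof -
  let ?A = "ae_tangent_bundle n U E D" and ?T = "tangent_bundle M :: (_, _, 'd) vbundle"
  let ?S = "Sigma M (tangent_space M)"
  have A: "topspace (total ?A) = fibre ` ?S"
    by (simp only: ae_tangent_bundle_simps topspace_quotient_topology quotient_pieces)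
  have cls: "ae_rel n U E D `` {(i, x, v)} = fibre (tangent_param (E i) (D i) (x, v))"
    and mem: "tangent_param (E i) (D i) (x, v) \<in> ?S"
    if "i \<in> {1..n}" "x \<in> U i" for i x v
    using ae_class[of "(i, x, v)"] param_in[of "(i, x, v)"] that by (simp_all add: topspace_pieces param_def)
  have "vb_hom ?A ?T to_tangent"
  proof (rule vb_homI, goal_cases)
    case 1
    \<comment> \<open>Continuity out of the quotient is tested on the pieces, where the composite is
      just \<open>param\<close>.\<close>
    have "continuous_map pieces (top_of_set ?S) (\<lambda>p. to_tangent (ae_rel n U E D `` {p}))"
      by (rule continuous_map_eq[OF continuous_map_param])
        (simp only: ae_class to_tangent_fibre[OF param_in])
    then show ?case
      by (simp only: ae_tangent_bundle_simps total_tangent_bundle continuous_map_from_quotient)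
  next
    case (2 e)
    then show ?case
      unfolding A using to_tangent_fibre proj_fibre by (metis imageE proj_tangent_bundle)
  next
    case (3 V \<phi> V' \<psi>)
    then obtain i where i: "i \<in> {1..n}" "V = U i" "\<phi> = (\<lambda>(x, v). ae_rel n U E D `` {(i, x, v)})"
      unfolding ae_tangent_bundle_simps by blast
    \<comment> \<open>Seen from piece \<open>i\<close> the map is \<open>tangent_param\<close>, so
      its matrices are those of chart transitions.\<close>
    have "to_tangent (\<phi> (x, v)) = tangent_param (E i) (D i) (x, v)" if "x \<in> U i" for x v
      using that i by (simp add: cls to_tangent_fibre mem)
    with chart_triv_transition(1)[OF chart[OF i(1)] 3(2)] show ?case
      by (simp add: i(2))
  qed
  moreover have "vb_hom ?T ?A fibre"
  proof (rule vb_homI, goal_cases)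
    case 1
    show ?case
      using continuous_map_fibre by (simp only: ae_tangent_bundle_simps total_tangent_bundle)
  next
    case (2 e)
    then show ?case
      by (simp add: proj_fibre)
  next
    case (3 V' \<psi> V \<phi>)
    then obtain i where i: "i \<in> {1..n}" "V = U i" "\<phi> = (\<lambda>(x, v). ae_rel n U E D `` {(i, x, v)})"
      unfolding ae_tangent_bundle_simps by blast
    from chart_triv_transition(2)[OF chart[OF i(1)] 3(1)]
    obtain h :: "real^'N \<Rightarrow> real^'d^'d" where h: "smooth_on (U i \<inter> V') h"
      "\<forall>x\<in>U i \<inter> V'. \<forall>v. \<psi> (x, v) = tangent_param (E i) (D i) (x, h x *v v)"
      by blast
    \<comment> \<open>Over \<open>U i\<close>, \<open>\<phi>\<close> is \<open>fibre\<close> after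
      \<open>tangent_param\<close>, so the matrix \<open>h x\<close> carries over unchanged.\<close>
    have "fibre (\<psi> (x, v)) = \<phi> (x, h x *v v)" if "x \<in> V' \<inter> V" for x v
      using that i h(2) by (simp add: cls)
    with h(1) show ?case
      by (intro exI[of _ h]) (simp add: i(2) Int_commute)
  qed
  ultimately show ?thesis
    unfolding vb_isomorphic_def
    by (intro exI[of _ to_tangent] exI[of _ fibre]) (auto simp: A to_tangent_fibre)
qed

end

section \<open>From good covers to atlases and back\<close>

theorem theorem5p7:
  fixes M :: "(real^'N::finite) set"
  assumes "smooth_manifold TYPE('d::finite) M"
  shows
    "(\<forall>n (U :: nat \<Rightarrow> (real^'N) set).
        good_cover M n U \<and>
        (\<forall>i\<in>{1..n}. \<exists>W :: (real^'d) set. open W \<and> diffeomorphic (U i) W) \<longrightarrow>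
        (\<exists>(E :: nat \<Rightarrow> real^'N \<Rightarrow> real^'d) (D :: nat \<Rightarrow> real^'d \<Rightarrow> real^'N).
           smooth_ae_atlas M n U E D \<and>
           vb_isomorphic (ae_tangent_bundle n U E D) (tangent_bundle M)))
     \<and>
     (\<forall>n (U :: nat \<Rightarrow> (real^'N) set)
         (E :: nat \<Rightarrow> real^'N \<Rightarrow> real^'d) (D :: nat \<Rightarrow> real^'d \<Rightarrow> real^'N).
        smooth_ae_atlas M n U E D \<and>
        vb_isomorphic (ae_tangent_bundle n U E D) (tangent_bundle M) \<longrightarrow>
        finite_open_cover M n U \<and>
        (\<forall>i\<in>{1..n}.
           trivial_over (tangent_bundle M :: (_, _, 'd) vbundle) (U i) \<and>
           (\<exists>W :: (real^'d) set. open W \<and> diffeomorphic (U i) W)))"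
proof (intro conjI allI impI, goal_cases)
  case (1 n U)
  then have cov: "finite_open_cover M n U"
    and "\<forall>i\<in>{1..n}. \<exists>(W :: (real^'d) set) E D. open W \<and> diffeomorphism (U i) W E D"
    unfolding good_cover_def diffeomorphic_def by blast+
  \<comment> \<open>The coordinate maps of the cover and their inverses serve as encoders and
    decoders.\<close>
  then obtain W :: "nat \<Rightarrow> (real^'d) set" and E D
    where WED: "\<forall>i\<in>{1..n}. open (W i) \<and> diffeomorphism (U i) (W i) (E i) (D i)"
    by metis
  have c: "chart M (U i) (W i) (E i) (D i)" if "i \<in> {1..n}" for i
    using WED cov that by (simp add: chart_def finite_open_cover_def)
  interpret chart_atlas M n U W E D
    using c cov by unfold_locales (simp_all add: finite_open_cover_def)
  have "smooth_ae_chart M (U i) (E i) (D i)" if "i \<in> {1..n}" for i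
    unfolding smooth_ae_chart_def
  proof (intro conjI)
    note c = c[OF that]
    show "openin (top_of_set M) (U i)"
      using chart_openin[OF c] .
    show "\<exists>G. diffeomorphism (U i) (E i ` U i) (E i) G"
      using c unfolding chart_image[OF c] chart_def by blast
    \<comment> \<open>The latent set is the coordinate domain \<open>W i\<close>, which is exactly
      the image of the encoder.\<close>
    show "\<exists>Z. E i ` U i \<subseteq> Z \<and> smooth_on Z (D i) \<and> D i ` Z \<subseteq> M"
      using chart_Cinf[OF c] chart_image[OF c] chart_inv_image[OF c] chart_subset[OF c]
      by (intro exI[of _ "W i"]) (simp add: Cinf_on_imp_smooth_on)
    show "\<forall>x\<in>U i. D i (E i x) = x"
      using chart_inv[OF c] by blast
  qed
  then have "smooth_ae_atlas M n U E D"
    using cov by (simp add: smooth_ae_atlas_def finite_open_cover_def)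
  with ae_tangent_bundle_isomorphic show ?case
    by blast
next
  case (2 n U E D)
  then show ?case
    by (simp add: smooth_ae_atlas_def smooth_ae_chart_def finite_open_cover_def)
next
  case (3 n U E D)
  show ?case
  proof
    fix i assume "i \<in> {1..n}"
    then have U: "openin (top_of_set M) (U i)" and "\<exists>G. diffeomorphism (U i) (E i ` U i) (E i) G"
      using 3 by (simp_all add: smooth_ae_atlas_def smooth_ae_chart_def)
    then obtain G where G: "diffeomorphism (U i) (E i ` U i) (E i) G"
      by blast
    have op: "open (E i ` U i)"
      using encoder_image_open[OF assms U G] .
    \<comment> \<open>The chart uses the smooth inverse \<open>G\<close> of the encoder, with which
      the decoder \<open>D i\<close> agrees on the open image.\<close>
    then have "chart M (U i) (E i ` U i) (E i) G"
      using U G by (simp add: chart_def)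
    then have "trivial_over (tangent_bundle M :: (_, _, 'd) vbundle) (U i)"
      by (rule tangent_bundle_trivial_over_chart)
    with op G show "trivial_over (tangent_bundle M :: (_, _, 'd) vbundle) (U i) \<and>
        (\<exists>W :: (real^'d) set. open W \<and> diffeomorphic (U i) W)"
      unfolding diffeomorphic_def by blast
  qed
qed

end
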